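(* Let $\overline{\mathcal{E}}$, $\mathcal{E}$, $X=\{a^{\pm1},b^{\pm1}\}$ be the Engel Lie group, its lattice and generating set as defined in the context, and for each positive integer $n$ let $g_n\in\overline{\mathcal{E}}$ be the element represented by the straight segment from $(0,0)$ to $(n,0)$. There exists a constant $C'>0$ such that, for all positive integers $n$ and all $\mathbb{R}$-words $w\in X_{\mathbb{R}}^*$ representing $g_n$, we have $$\ell(w)-\|g_n\|_{\mathrm{Stoll},X}\ \ge\ C'\cdot k(w)^{-\frac23}\cdot\|g_n\|_{\mathrm{Stoll},X}.$$ If moreover $n\equiv0\pmod{6}$, then $g_n\in\mathcal{E}$ and $\|g_n\|_X-\|g_n\|_{\mathrm{Stoll},X}=\Omega\big(\|g_n\|_{\mathrm{Stoll},X}^{1/3}\big)$, i.e. there is $c>0$ such that $\|g_n\|_X-\|g_n\|_{\mathrm{Stoll},X}\ge c\,\|g_n\|_{\mathrm{Stoll},X}^{1/3}$ for all such $n$.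
   Context: Let $\Gamma$ be the monoid of absolutely continuous paths in $\mathbb{R}^2$ starting at $(0,0)$, under concatenation ($gh$ follows $g$ and then the translate of $h$ starting at the endpoint of $g$). For $g\in\Gamma$ let $\hat g=(x_g,y_g)$ be its endpoint, let $g_c$ be the closed path obtained by concatenating $g$ with the segment from $\hat g$ back to $(0,0)$, and let $W_g(x,y)$ be the winding number of $g_c$ around $(x,y)\notin\mathrm{Im}(g_c)$. Put $A(g)=\iint_{\mathbb{R}^2}W_g(x,y)\,dx\,dy$ and $B_y(g)=\iint_{\mathbb{R}^2}y\,W_g(x,y)\,dx\,dy$. Two paths $g,h$ are equivalent if $\hat g=\hat h$, $A(g)=A(h)$ and $B_y(g)=B_y(h)$. The Engel Lie group $\overline{\mathcal{E}}$ is the quotient of $\Gamma$ by this equivalence relation, with concatenation as operation. Let $a,b\in\overline{\mathcal{E}}$ be represented by the straight segments from $(0,0)$ to $(1,1)$ and to $(1,-1)$ respectively; $\mathcal{E}$ is the subgroup generated by $a,b$ (a cocompact lattice), and $X=\{a,a^{-1},b,b^{-1}\}$. For $\mu>0$, the powers $a^{\mu},(a^{-1})^{\mu},b^{\mu},(b^{-1})^{\mu}$ are represented by the segments from $(0,0)$ to $(\mu,\mu),(-\mu,-\mu),(\mu,-\mu),(-\mu,\mu)$. An $\mathbb{R}$-word over $X$ is an expression $w=x_1^{\mu_1}\cdots x_k^{\mu_k}$ with $x_i\in X$, $x_i\neq x_{i+1}$, $\mu_i\in\mathbb{R}_{>0}$; $X_{\mathbb{R}}^*$ is the set of $\mathbb{R}$-words.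 Its coarse length is $k(w)=k$, its length is $\ell(w)=\sum_i\mu_i$, and $\overline w\in\overline{\mathcal{E}}$ is its evaluation; $w$ represents $g$ if $\overline w=g$. The Stoll norm is $\|g\|_{\mathrm{Stoll},X}=\inf\{\ell(w):w\in X_{\mathbb{R}}^*,\ \overline w=g\}$ for $g\in\overline{\mathcal{E}}$, and $\|g\|_X$ is the usual word norm of $g\in\mathcal{E}$ with respect to $X$.
   Formalization: The second part assumes n≡0 (mod 12) instead of n≡0 (mod 6): for n≡6 (mod 12), words ending at (n,0) have area ≡(n/2)² (mod 2), which is odd, while A(g_n)=0, so g_n is not in the lattice and the claim fails. *)

theory Defs
  imports "HOL-Complex_Analysis.Complex_Analysis" "HOL-Algebra.Generated_Groups"
begin

text \<open>The plane is identified with the complex numbers, $(x,y) = x + iy$, so that the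
  library's winding numbers apply.  A path is a function on the reals of which only the
  restriction to $[0,1]$ matters.\<close>

definition abs_continuous_on_interval ::
    "real \<Rightarrow> real \<Rightarrow> (real \<Rightarrow> 'a::metric_space) \<Rightarrow> bool" where
  "abs_continuous_on_interval u v f \<longleftrightarrow>
     (\<forall>\<epsilon>>0. \<exists>\<delta>>0. \<forall>(m::nat) s t.
        (\<forall>i<m. u \<le> s i \<and> s i \<le> t i \<and> t i \<le> v) \<and>
        (\<forall>i<m. \<forall>j<m. i \<noteq> j \<longrightarrow> {s i<..<t i} \<inter> {s j<..<t j} = {}) \<and>
        (\<Sum>i<m. t i - s i) < \<delta>
        \<longrightarrow> (\<Sum>i<m. dist (f (s i)) (f (t i))) < \<epsilon>)"

definition plane_paths :: "(real \<Rightarrow> complex) set" where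
  "plane_paths = {g. abs_continuous_on_interval 0 1 g \<and> pathstart g = 0}"

definition concat_path :: "(real \<Rightarrow> complex) \<Rightarrow> (real \<Rightarrow> complex) \<Rightarrow> real \<Rightarrow> complex" where
  "concat_path g h = g +++ (\<lambda>t. pathfinish g + h t)"

definition closed_up :: "(real \<Rightarrow> complex) \<Rightarrow> real \<Rightarrow> complex" where
  "closed_up g = g +++ linepath (pathfinish g) 0"

text \<open>The winding number is only meaningful off the image of the closed path, which is a null
  set for absolutely continuous paths; hence the integrals over the complement of that image.
  The real part only changes the type: winding numbers of closed paths are integers.\<close>

definition winding_fun :: "(real \<Rightarrow> complex) \<Rightarrow> complex \<Rightarrow> real" where
  "winding_fun g z = Re (winding_number (closed_up g) z)"

definition area :: "(real \<Rightarrow> complex) \<Rightarrow> real" where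
  "area g = (LINT z : - path_image (closed_up g) | lebesgue. winding_fun g z)"

definition y_moment :: "(real \<Rightarrow> complex) \<Rightarrow> real" where
  "y_moment g = (LINT z : - path_image (closed_up g) | lebesgue. Im z * winding_fun g z)"

definition engel_rel :: "((real \<Rightarrow> complex) \<times> (real \<Rightarrow> complex)) set" where
  "engel_rel = {(g, h). g \<in> plane_paths \<and> h \<in> plane_paths \<and>
     pathfinish g = pathfinish h \<and> area g = area h \<and> y_moment g = y_moment h}"

definition engel_class :: "(real \<Rightarrow> complex) \<Rightarrow> (real \<Rightarrow> complex) set" where
  "engel_class g = engel_rel `` {g}"

text \<open>Concatenation respects the equivalence relation, so the union defining the product is
  the single class of any concatenation of representatives.\<close>

definition Engel :: "(real \<Rightarrow> complex) set monoid" where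
  "Engel = \<lparr>carrier = plane_paths // engel_rel,
            mult = (\<lambda>U V. \<Union>g\<in>U. \<Union>h\<in>V. engel_class (concat_path g h)),
            one = engel_class (\<lambda>_. 0)\<rparr>"

definition segment_elt :: "complex \<Rightarrow> (real \<Rightarrow> complex) set" where
  "segment_elt v = engel_class (linepath 0 v)"

definition gen_a :: "(real \<Rightarrow> complex) set" where
  "gen_a = segment_elt (Complex 1 1)"

definition gen_b :: "(real \<Rightarrow> complex) set" where
  "gen_b = segment_elt (Complex 1 (-1))"

definition engel_lattice :: "(real \<Rightarrow> complex) set set" where
  "engel_lattice = generate Engel {gen_a, gen_b}"

definition engel_gens :: "(real \<Rightarrow> complex) set set" where
  "engel_gens = {gen_a, inv\<^bsub>Engel\<^esub> gen_a, gen_b, inv\<^bsub>Engel\<^esub> gen_b}"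

definition word_norm :: "('a, 'b) monoid_scheme \<Rightarrow> 'a set \<Rightarrow> 'a \<Rightarrow> nat" where
  "word_norm G X g =
     (LEAST n. \<exists>xs. length xs = n \<and> set xs \<subseteq> X \<and> foldr (\<otimes>\<^bsub>G\<^esub>) xs \<one>\<^bsub>G\<^esub> = g)"

text \<open>The letters are formal symbols for the four elements of the generating set; the power
  with exponent $\mu > 0$ of a letter is the class of the segment from $0$ to $\mu$ times the
  endpoint of that generator.\<close>

datatype letter = La | La_inv | Lb | Lb_inv

fun letter_vec :: "letter \<Rightarrow> complex" where
  "letter_vec La = Complex 1 1"
| "letter_vec La_inv = Complex (-1) (-1)"
| "letter_vec Lb = Complex 1 (-1)"
| "letter_vec Lb_inv = Complex (-1) 1"

definition letter_power :: "letter \<Rightarrow> real \<Rightarrow> (real \<Rightarrow> complex) set" where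
  "letter_power x \<mu> = segment_elt (\<mu> *\<^sub>R letter_vec x)"

type_synonym rword = "(letter \<times> real) list"

definition rwords :: "rword set" where
  "rwords = {w. (\<forall>(x, \<mu>) \<in> set w. \<mu> > 0) \<and> distinct_adj (map fst w)}"

definition coarse_length :: "rword \<Rightarrow> nat" where
  "coarse_length w = length w"

definition rword_length :: "rword \<Rightarrow> real" where
  "rword_length w = (\<Sum>(x, \<mu>)\<leftarrow>w. \<mu>)"

definition rword_eval :: "rword \<Rightarrow> (real \<Rightarrow> complex) set" where
  "rword_eval w = foldr (\<otimes>\<^bsub>Engel\<^esub>) (map (\<lambda>(x, \<mu>). letter_power x \<mu>) w) \<one>\<^bsub>Engel\<^esub>"

definition stoll_norm :: "(real \<Rightarrow> complex) set \<Rightarrow> real" where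
  "stoll_norm g = Inf {rword_length w | w. w \<in> rwords \<and> rword_eval w = g}"

text \<open>Membership of \<open>horizontal_elt n\<close> in the lattice requires $12 \mid n$; divisibility by $6$
  is not enough.  The endpoint $(n,0)$ forces both generators to have exponent sum $n/2$, and the
  area of a word in the generators is a sum of one sign for each pair consisting of a letter
  $a^{\pm1}$ and a letter $b^{\pm1}$, hence is congruent to $(n/2)^2$ modulo $2$, whereas the area
  of \<open>horizontal_elt n\<close> is zero; so $4 \mid n$.  Divisibility by $3$ comes from the $y$-moment.\<close>

definition horizontal_elt :: "nat \<Rightarrow> (real \<Rightarrow> complex) set" where
  "horizontal_elt n = segment_elt (of_nat n)"

end

theory Submission
  imports Defs
begin

text \<open>Every edge of a polygon representing \<open>g\<^sub>n\<close> has slope \<open>1\<close> or \<open>-1\<close>, the polygon returns to the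
  axis, and \<open>y\<^sup>2 dx\<close> integrates to \<open>0\<close> along it because its \<open>y\<close>-moment vanishes.  The edges running
  to the right contribute at least a multiple of \<open>n\<^sup>3 / k\<^sup>2\<close> to this integral.  They have to be
  compensated by edges running to the left, of total length \<open>M = (l - n) / 2\<close>, and these can
  contribute at most a multiple of \<open>M\<^sup>3\<close>, since climbing high is itself expensive.  Hence
  \<open>M \<ge> c k\<^bsup>-2/3\<^esup> n\<close>, while zigzags with one large backward tooth show that the Stoll norm of
  \<open>g\<^sub>n\<close> is at most \<open>n\<close>.

  To multiply in the group one needs that area and \<open>y\<close>-moment of a concatenation are determined by those
  of the factors, for arbitrary absolutely continuous representatives.  Winding numbers are
  additive up to a triangle, so what matters is that they are integrable; this follows
  from Fatou's lemma, because the winding function of a path is almost everywhere the limit of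
  sums of winding functions of thin triangles with apex \<open>0\<close>, whose areas are bounded by the length.\<close>

section \<open>Absolutely continuous paths\<close>

text \<open>Elimination form in which disjointness is checked for \<open>i < j\<close> only; the
  condition is symmetric in the two intervals.\<close>

lemma abs_continuous_on_intervalD:
  assumes "abs_continuous_on_interval u v f" "\<epsilon> > 0"
  obtains \<delta> where "\<delta> > 0"
    "\<And>(m::nat) s t. (\<And>i. i < m \<Longrightarrow> u \<le> s i \<and> s i \<le> t i \<and> t i \<le> v) \<Longrightarrow>
       (\<And>i j. i < m \<Longrightarrow> j < m \<Longrightarrow> i < j \<Longrightarrow> {s i<..<t i} \<inter> {s j<..<t j} = {}) \<Longrightarrow>
       (\<Sum>i<m. t i - s i) < \<delta> \<Longrightarrow> (\<Sum>i<m. dist (f (s i)) (f (t i))) < \<epsilon>"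
proof -
  have "\<exists>\<delta>>0. \<forall>(m::nat) s t.
        (\<forall>i<m. u \<le> s i \<and> s i \<le> t i \<and> t i \<le> v) \<and>
        (\<forall>i<m. \<forall>j<m. i \<noteq> j \<longrightarrow> {s i<..<t i} \<inter> {s j<..<t j} = {}) \<and>
        (\<Sum>i<m. t i - s i) < \<delta>
        \<longrightarrow> (\<Sum>i<m. dist (f (s i)) (f (t i))) < \<epsilon>"
    using spec[OF assms(1)[unfolded abs_continuous_on_interval_def], of \<epsilon>] assms(2) by (rule mp)
  then obtain \<delta> where \<delta>: "\<delta> > 0" and *: "\<forall>(m::nat) s t.
        (\<forall>i<m. u \<le> s i \<and> s i \<le> t i \<and> t i \<le> v) \<and>
        (\<forall>i<m. \<forall>j<m. i \<noteq> j \<longrightarrow> {s i<..<t i} \<inter> {s j<..<t j} = {}) \<and>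
        (\<Sum>i<m. t i - s i) < \<delta>
        \<longrightarrow> (\<Sum>i<m. dist (f (s i)) (f (t i))) < \<epsilon>"
    by (elim exE conjE)
  show thesis
  proof (rule that[OF \<delta>])
    fix m :: nat and s t
    assume 1: "\<And>i. i < m \<Longrightarrow> u \<le> s i \<and> s i \<le> t i \<and> t i \<le> v"
      and 2: "\<And>i j. i < m \<Longrightarrow> j < m \<Longrightarrow> i < j \<Longrightarrow> {s i<..<t i} \<inter> {s j<..<t j} = {}"
      and 3: "(\<Sum>i<m. t i - s i) < \<delta>"
    have "{s i<..<t i} \<inter> {s j<..<t j} = {}" if "i < m" "j < m" "i \<noteq> j" for i j
      using 2[of i j] 2[of j i] that by (cases i j rule: linorder_cases) blast+
    with 1 3 show "(\<Sum>i<m. dist (f (s i)) (f (t i))) < \<epsilon>"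
      using *[THEN spec, THEN spec, THEN spec, of m s t] by blast
  qed
qed

text \<open>A family consisting of a single interval yields uniform continuity.\<close>

lemma abs_continuous_uniform:
  assumes "abs_continuous_on_interval u v f" "\<epsilon> > 0"
  obtains \<delta> where "\<delta> > 0"
    "\<And>x y. x \<in> {u..v} \<Longrightarrow> y \<in> {u..v} \<Longrightarrow> \<bar>x - y\<bar> < \<delta> \<Longrightarrow> dist (f x) (f y) < \<epsilon>"
proof -
  obtain \<delta> where "\<delta> > 0" and *:
    "\<And>(m::nat) s t. (\<And>i. i < m \<Longrightarrow> u \<le> s i \<and> s i \<le> t i \<and> t i \<le> v) \<Longrightarrow>
       (\<And>i j. i < m \<Longrightarrow> j < m \<Longrightarrow> i < j \<Longrightarrow> {s i<..<t i} \<inter> {s j<..<t j} = {}) \<Longrightarrow>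
       (\<Sum>i<m. t i - s i) < \<delta> \<Longrightarrow> (\<Sum>i<m. dist (f (s i)) (f (t i))) < \<epsilon>"
    using abs_continuous_on_intervalD[OF assms] by blast
  have le: "dist (f x) (f y) < \<epsilon>" if "x \<in> {u..v}" "y \<in> {u..v}" "\<bar>x - y\<bar> < \<delta>" "x \<le> y" for x y
    using *[of 1 "\<lambda>_. x" "\<lambda>_. y"] that by simp
  show thesis
  proof (rule that[OF \<open>\<delta> > 0\<close>])
    fix x y assume "x \<in> {u..v}" "y \<in> {u..v}" "\<bar>x - y\<bar> < \<delta>"
    then show "dist (f x) (f y) < \<epsilon>"
      using le[of x y] le[of y x] by (cases "x \<le> y") (auto simp: dist_commute abs_minus_commute)
  qed
qed

lemma abs_continuous_imp_path:
  assumes "abs_continuous_on_interval 0 1 g"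
  shows "path g"
  unfolding path_def continuous_on_iff
proof (intro ballI allI impI)
  fix x \<epsilon> :: real assume x: "x \<in> {0..1}" and "\<epsilon> > 0"
  then obtain \<delta> where "\<delta> > 0"
    and *: "\<And>x y. x \<in> {0..1} \<Longrightarrow> y \<in> {0..1} \<Longrightarrow> \<bar>x - y\<bar> < \<delta> \<Longrightarrow> dist (g x) (g y) < \<epsilon>"
    using abs_continuous_uniform[OF assms] by metis
  then show "\<exists>d>0. \<forall>x'\<in>{0..1}. dist x' x < d \<longrightarrow> dist (g x') (g x) < \<epsilon>"
    using x by (intro exI[of _ \<delta>]) (auto simp: dist_real_def)
qed

lemma abs_continuous_lipschitz:
  fixes f :: "real \<Rightarrow> 'a::metric_space"
  assumes "\<And>x y. u \<le> x \<Longrightarrow> x \<le> y \<Longrightarrow> y \<le> v \<Longrightarrow> dist (f x) (f y) \<le> L * (y - x)"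
  shows "abs_continuous_on_interval u v f"
  unfolding abs_continuous_on_interval_def
proof (intro allI impI)
  fix \<epsilon> :: real assume "\<epsilon> > 0"
  \<comment> \<open>\<open>L\<close> may be zero or negative, so the division below uses a positive
    constant above it.\<close>
  define M where "M = \<bar>L\<bar> + 1"
  have "M > 0" by (simp add: M_def)
  show "\<exists>\<delta>>0. \<forall>(m::nat) s t.
        (\<forall>i<m. u \<le> s i \<and> s i \<le> t i \<and> t i \<le> v) \<and>
        (\<forall>i<m. \<forall>j<m. i \<noteq> j \<longrightarrow> {s i<..<t i} \<inter> {s j<..<t j} = {}) \<and>
        (\<Sum>i<m. t i - s i) < \<delta>
        \<longrightarrow> (\<Sum>i<m. dist (f (s i)) (f (t i))) < \<epsilon>"
  proof (intro exI[of _ "\<epsilon> / M"] conjI allI impI; (elim conjE)?)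
    show "\<epsilon> / M > 0" using \<open>\<epsilon> > 0\<close> \<open>M > 0\<close> by simp
    fix m :: nat and s t
    assume 1: "\<forall>i<m. u \<le> s i \<and> s i \<le> t i \<and> t i \<le> v" and 2: "(\<Sum>i<m. t i - s i) < \<epsilon> / M"
    have "(\<Sum>i<m. dist (f (s i)) (f (t i))) \<le> (\<Sum>i<m. M * (t i - s i))"
    proof (rule sum_mono)
      fix i assume "i \<in> {..<m}"
      then have i: "u \<le> s i" "s i \<le> t i" "t i \<le> v" using 1 by auto
      have "dist (f (s i)) (f (t i)) \<le> L * (t i - s i)" using i assms by blast
      also have "\<dots> \<le> M * (t i - s i)" unfolding M_def using i by (intro mult_right_mono) auto
      finally show "dist (f (s i)) (f (t i)) \<le> M * (t i - s i)" .
    qed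
    also have "\<dots> = M * (\<Sum>i<m. t i - s i)" by (simp add: sum_distrib_left)
    also have "\<dots> < \<epsilon>" using 2 \<open>M > 0\<close> by (simp add: field_simps)
    finally show "(\<Sum>i<m. dist (f (s i)) (f (t i))) < \<epsilon>" .
  qed
qed

lemma abs_continuous_linepath: "abs_continuous_on_interval 0 1 (linepath a b)"
proof (rule abs_continuous_lipschitz)
  fix x y :: real assume "x \<le> y"
  have "linepath a b x - linepath a b y = (y - x) *\<^sub>R (a - b)"
    by (simp add: linepath_def algebra_simps)
  then show "dist (linepath a b x) (linepath a b y) \<le> norm (a - b) * (y - x)"
    using \<open>x \<le> y\<close> by (simp add: dist_norm)
qed

lemma abs_continuous_cong:
  assumes "abs_continuous_on_interval u v f" "\<And>x. u \<le> x \<Longrightarrow> x \<le> v \<Longrightarrow> f x = g x"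
  shows "abs_continuous_on_interval u v g"
  unfolding abs_continuous_on_interval_def
proof (intro allI impI)
  fix \<epsilon> :: real assume "\<epsilon> > 0"
  then obtain \<delta> where "\<delta> > 0" and *:
    "\<And>(m::nat) s t. (\<And>i. i < m \<Longrightarrow> u \<le> s i \<and> s i \<le> t i \<and> t i \<le> v) \<Longrightarrow>
       (\<And>i j. i < m \<Longrightarrow> j < m \<Longrightarrow> i < j \<Longrightarrow> {s i<..<t i} \<inter> {s j<..<t j} = {}) \<Longrightarrow>
       (\<Sum>i<m. t i - s i) < \<delta> \<Longrightarrow> (\<Sum>i<m. dist (f (s i)) (f (t i))) < \<epsilon>"
    using abs_continuous_on_intervalD[OF assms(1)] by blast
  show "\<exists>\<delta>>0. \<forall>(m::nat) s t.
        (\<forall>i<m. u \<le> s i \<and> s i \<le> t i \<and> t i \<le> v) \<and>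
        (\<forall>i<m. \<forall>j<m. i \<noteq> j \<longrightarrow> {s i<..<t i} \<inter> {s j<..<t j} = {}) \<and>
        (\<Sum>i<m. t i - s i) < \<delta>
        \<longrightarrow> (\<Sum>i<m. dist (g (s i)) (g (t i))) < \<epsilon>"
  proof (intro exI[of _ \<delta>] conjI allI impI; (elim conjE)?)
    fix m :: nat and s t
    assume 1: "\<forall>i<m. u \<le> s i \<and> s i \<le> t i \<and> t i \<le> v"
      and 2: "\<forall>i<m. \<forall>j<m. i \<noteq> j \<longrightarrow> {s i<..<t i} \<inter> {s j<..<t j} = {}"
      and 3: "(\<Sum>i<m. t i - s i) < \<delta>"
    have "(\<Sum>i<m. dist (f (s i)) (f (t i))) < \<epsilon>"
      using 1 2 3 by (intro *) auto
    moreover have "(\<Sum>i<m. dist (f (s i)) (f (t i))) = (\<Sum>i<m. dist (g (s i)) (g (t i)))"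
      using 1 by (intro sum.cong refl) (smt (verit) assms(2) lessThan_iff)
    ultimately show "(\<Sum>i<m. dist (g (s i)) (g (t i))) < \<epsilon>" by simp
  qed fact
qed

lemma abs_continuous_add:
  fixes f g :: "real \<Rightarrow> 'a::real_normed_vector"
  assumes "abs_continuous_on_interval u v f" "abs_continuous_on_interval u v g"
  shows "abs_continuous_on_interval u v (\<lambda>x. f x + g x)"
  unfolding abs_continuous_on_interval_def
proof (intro allI impI)
  fix \<epsilon> :: real assume "\<epsilon> > 0"
  then have e2: "\<epsilon> / 2 > 0" by simp
  obtain \<delta>1 where d1: "\<delta>1 > 0" and f:
    "\<And>(m::nat) s t. (\<And>i. i < m \<Longrightarrow> u \<le> s i \<and> s i \<le> t i \<and> t i \<le> v) \<Longrightarrow>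
       (\<And>i j. i < m \<Longrightarrow> j < m \<Longrightarrow> i < j \<Longrightarrow> {s i<..<t i} \<inter> {s j<..<t j} = {}) \<Longrightarrow>
       (\<Sum>i<m. t i - s i) < \<delta>1 \<Longrightarrow> (\<Sum>i<m. dist (f (s i)) (f (t i))) < \<epsilon> / 2"
    using abs_continuous_on_intervalD[OF assms(1) e2] by blast
  obtain \<delta>2 where d2: "\<delta>2 > 0" and g:
    "\<And>(m::nat) s t. (\<And>i. i < m \<Longrightarrow> u \<le> s i \<and> s i \<le> t i \<and> t i \<le> v) \<Longrightarrow>
       (\<And>i j. i < m \<Longrightarrow> j < m \<Longrightarrow> i < j \<Longrightarrow> {s i<..<t i} \<inter> {s j<..<t j} = {}) \<Longrightarrow>
       (\<Sum>i<m. t i - s i) < \<delta>2 \<Longrightarrow> (\<Sum>i<m. dist (g (s i)) (g (t i))) < \<epsilon> / 2"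
    using abs_continuous_on_intervalD[OF assms(2) e2] by blast
  show "\<exists>\<delta>>0. \<forall>(m::nat) s t.
        (\<forall>i<m. u \<le> s i \<and> s i \<le> t i \<and> t i \<le> v) \<and>
        (\<forall>i<m. \<forall>j<m. i \<noteq> j \<longrightarrow> {s i<..<t i} \<inter> {s j<..<t j} = {}) \<and>
        (\<Sum>i<m. t i - s i) < \<delta>
        \<longrightarrow> (\<Sum>i<m. dist (f (s i) + g (s i)) (f (t i) + g (t i))) < \<epsilon>"
  proof (intro exI[of _ "min \<delta>1 \<delta>2"] conjI allI impI; (elim conjE)?)
    show "min \<delta>1 \<delta>2 > 0" using d1 d2 by simp
    fix m :: nat and s t
    assume 1: "\<forall>i<m. u \<le> s i \<and> s i \<le> t i \<and> t i \<le> v"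
      and 2: "\<forall>i<m. \<forall>j<m. i \<noteq> j \<longrightarrow> {s i<..<t i} \<inter> {s j<..<t j} = {}"
      and 3: "(\<Sum>i<m. t i - s i) < min \<delta>1 \<delta>2"
    have "(\<Sum>i<m. dist (f (s i)) (f (t i))) < \<epsilon> / 2" using 1 2 3 by (intro f) auto
    moreover have "(\<Sum>i<m. dist (g (s i)) (g (t i))) < \<epsilon> / 2" using 1 2 3 by (intro g) auto
    moreover have "(\<Sum>i<m. dist (f (s i) + g (s i)) (f (t i) + g (t i)))
        \<le> (\<Sum>i<m. dist (f (s i)) (f (t i)) + dist (g (s i)) (g (t i)))"
      by (intro sum_mono dist_triangle_add)
    ultimately show "(\<Sum>i<m. dist (f (s i) + g (s i)) (f (t i) + g (t i))) < \<epsilon>"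
      by (simp add: sum.distrib)
  qed
qed

text \<open>A monotone Lipschitz reparametrisation carries disjoint intervals to disjoint intervals
  and multiplies their total length by at most \<open>L\<close>.\<close>

lemma abs_continuous_compose:
  assumes "abs_continuous_on_interval a b g"
    and range: "\<And>x. u \<le> x \<Longrightarrow> x \<le> v \<Longrightarrow> a \<le> \<phi> x \<and> \<phi> x \<le> b"
    and mono: "\<And>x y. u \<le> x \<Longrightarrow> x \<le> y \<Longrightarrow> y \<le> v \<Longrightarrow> \<phi> x \<le> \<phi> y"
    and lip: "\<And>x y. u \<le> x \<Longrightarrow> x \<le> y \<Longrightarrow> y \<le> v \<Longrightarrow> \<phi> y - \<phi> x \<le> L * (y - x)"
    and "L > 0"
  shows "abs_continuous_on_interval u v (\<lambda>x. g (\<phi> x))"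
  unfolding abs_continuous_on_interval_def
proof (intro allI impI)
  fix \<epsilon> :: real assume "\<epsilon> > 0"
  then obtain \<delta> where "\<delta> > 0" and *:
    "\<And>(m::nat) s t. (\<And>i. i < m \<Longrightarrow> a \<le> s i \<and> s i \<le> t i \<and> t i \<le> b) \<Longrightarrow>
       (\<And>i j. i < m \<Longrightarrow> j < m \<Longrightarrow> i < j \<Longrightarrow> {s i<..<t i} \<inter> {s j<..<t j} = {}) \<Longrightarrow>
       (\<Sum>i<m. t i - s i) < \<delta> \<Longrightarrow> (\<Sum>i<m. dist (g (s i)) (g (t i))) < \<epsilon>"
    using abs_continuous_on_intervalD[OF assms(1)] by blast
  show "\<exists>\<delta>>0. \<forall>(m::nat) s t.
        (\<forall>i<m. u \<le> s i \<and> s i \<le> t i \<and> t i \<le> v) \<and>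
        (\<forall>i<m. \<forall>j<m. i \<noteq> j \<longrightarrow> {s i<..<t i} \<inter> {s j<..<t j} = {}) \<and>
        (\<Sum>i<m. t i - s i) < \<delta>
        \<longrightarrow> (\<Sum>i<m. dist (g (\<phi> (s i))) (g (\<phi> (t i)))) < \<epsilon>"
  proof (intro exI[of _ "\<delta> / L"] conjI allI impI; (elim conjE)?)
    show "\<delta> / L > 0" using \<open>\<delta> > 0\<close> \<open>L > 0\<close> by simp
    fix m :: nat and s t
    assume 1: "\<forall>i<m. u \<le> s i \<and> s i \<le> t i \<and> t i \<le> v"
      and 2: "\<forall>i<m. \<forall>j<m. i \<noteq> j \<longrightarrow> {s i<..<t i} \<inter> {s j<..<t j} = {}"
      and 3: "(\<Sum>i<m. t i - s i) < \<delta> / L"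
    show "(\<Sum>i<m. dist (g (\<phi> (s i))) (g (\<phi> (t i)))) < \<epsilon>"
    proof (rule *)
      fix i assume "i < m"
      with 1 have i: "u \<le> s i" "s i \<le> t i" "t i \<le> v" by auto
      show "a \<le> \<phi> (s i) \<and> \<phi> (s i) \<le> \<phi> (t i) \<and> \<phi> (t i) \<le> b"
        using range[of "s i"] range[of "t i"] mono[of "s i" "t i"] i by auto
    next
      fix i j assume ij: "i < m" "j < m" "i < j"
      with 1 have i: "u \<le> s i" "s i \<le> t i" "t i \<le> v" and j: "u \<le> s j" "s j \<le> t j" "t j \<le> v"
        by auto
      have "{s i<..<t i} \<inter> {s j<..<t j} = {}" using 2 ij by auto
      then have "{max (s i) (s j)<..<min (t i) (t j)} = {}" by auto
      then have "min (t i) (t j) \<le> max (s i) (s j)" by simp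
      \<comment> \<open>Empty intervals are disjoint from everything, hence the two degenerate cases
        besides the two orderings.\<close>
      then consider "s i = t i" | "s j = t j" | "t i \<le> s j" | "t j \<le> s i"
        using i j by linarith
      then show "{\<phi> (s i)<..<\<phi> (t i)} \<inter> {\<phi> (s j)<..<\<phi> (t j)} = {}"
      proof cases
        case 3 then show ?thesis using mono[of "t i" "s j"] i j by fastforce
      next
        case 4 then show ?thesis using mono[of "t j" "s i"] i j by fastforce
      qed auto
    next
      have "(\<Sum>i<m. \<phi> (t i) - \<phi> (s i)) \<le> (\<Sum>i<m. L * (t i - s i))"
        using 1 lip by (intro sum_mono) auto
      also have "\<dots> = L * (\<Sum>i<m. t i - s i)" by (simp add: sum_distrib_left)
      also have "\<dots> < \<delta>" using 3 \<open>L > 0\<close> by (simp add: field_simps)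
      finally show "(\<Sum>i<m. \<phi> (t i) - \<phi> (s i)) < \<delta>" .
    qed
  qed
qed

lemma abs_continuous_translate:
  fixes g :: "real \<Rightarrow> 'a::real_normed_vector"
  assumes "abs_continuous_on_interval u v g"
  shows "abs_continuous_on_interval u v (\<lambda>t. p + g t)"
  using assms unfolding abs_continuous_on_interval_def by simp

text \<open>The join is, up to a constant, the sum of two reparametrised paths, each of them
  stationary on one half of the unit interval. In this way no interval has to be cut at the
  midpoint.\<close>

lemma abs_continuous_joinpaths:
  fixes g h :: "real \<Rightarrow> 'a::real_normed_vector"
  assumes "abs_continuous_on_interval 0 1 g" "abs_continuous_on_interval 0 1 h"
    "pathfinish g = pathstart h"
  shows "abs_continuous_on_interval 0 1 (g +++ h)"
proof -
  have "abs_continuous_on_interval 0 1 (\<lambda>x. g (min (2 * x) 1))"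
    by (rule abs_continuous_compose[OF assms(1), where L = 2]) auto
  moreover have "abs_continuous_on_interval 0 1 (\<lambda>x. - pathstart h + h (max (2 * x - 1) 0))"
    by (rule abs_continuous_translate, rule abs_continuous_compose[OF assms(2), where L = 2]) auto
  ultimately show ?thesis
  proof (rule abs_continuous_cong[OF abs_continuous_add])
    fix x :: real assume "0 \<le> x" "x \<le> 1"
    then show "g (min (2 * x) 1) + (- pathstart h + h (max (2 * x - 1) 0)) = (g +++ h) x"
      using assms(3) by (cases "x \<le> 1 / 2") (auto simp: joinpaths_def pathstart_def pathfinish_def
        min_def max_def)
  qed
qed

section \<open>Bounded variation and null images\<close>

text \<open>Take \<delta> for \<epsilon> = 1 and \<open>1 / N < \<delta>\<close>: each of the
  \<open>N\<close> blocks of \<open>m\<close> consecutive subintervals then has variation below 1.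
  The points \<open>\<tau> i\<close> are left free: right endpoints give the edges of an inscribed
  polygon, farthest points the radii of a covering by disks.\<close>

lemma abs_continuous_bounded_variation:
  fixes g :: "real \<Rightarrow> 'a::metric_space"
  assumes "abs_continuous_on_interval 0 1 g"
  obtains N :: nat where "N > 0"
    "\<And>m \<tau>. m > 0 \<Longrightarrow> (\<And>i. i < N * m \<Longrightarrow> real i / real (N * m) \<le> \<tau> i \<and> \<tau> i \<le> real (Suc i) / real (N * m)) \<Longrightarrow>
      (\<Sum>i<N * m. dist (g (real i / real (N * m))) (g (\<tau> i))) \<le> real N"
proof -
  obtain \<delta> where "\<delta> > 0" and *:
    "\<And>(m::nat) s t. (\<And>i. i < m \<Longrightarrow> 0 \<le> s i \<and> s i \<le> t i \<and> t i \<le> 1) \<Longrightarrow>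
       (\<And>i j. i < m \<Longrightarrow> j < m \<Longrightarrow> i < j \<Longrightarrow> {s i<..<t i} \<inter> {s j<..<t j} = {}) \<Longrightarrow>
       (\<Sum>i<m. t i - s i) < \<delta> \<Longrightarrow> (\<Sum>i<m. dist (g (s i)) (g (t i))) < 1"
    using abs_continuous_on_intervalD[OF assms zero_less_one] by blast
  obtain N :: nat where N: "N > 0" "1 / real N < \<delta>"
    using \<open>\<delta> > 0\<close> by (metis nat_approx_posE of_nat_Suc zero_less_Suc)
  show thesis
  proof (rule that[OF N(1)])
    fix m :: nat and \<tau>
    assume m: "m > 0" and
      \<tau>: "\<And>i. i < N * m \<Longrightarrow> real i / real (N * m) \<le> \<tau> i \<and> \<tau> i \<le> real (Suc i) / real (N * m)"
    let ?f = "\<lambda>i. dist (g (real i / real (N * m))) (g (\<tau> i))"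
    have K: "real (N * m) > 0" using N(1) m by simp
    have block: "sum ?f {j * m..<j * m + m} \<le> 1" if "j < N" for j
    proof -
      have lt: "r + j * m < N * m" if "r < m" for r
      proof -
        have "r + j * m < Suc j * m" using that by simp
        also have "\<dots> \<le> N * m" using \<open>j < N\<close> by (intro mult_right_mono) auto
        finally show ?thesis .
      qed
      have "sum ?f {j * m..<j * m + m} = (\<Sum>r<m. ?f (r + j * m))"
        using sum.shift_bounds_nat_ivl[of ?f 0 "j * m" m] by (simp add: atLeast0LessThan add.commute)
      also have "\<dots> < 1"
      proof (rule *)
        fix r assume "r < m"
        with lt have 1: "r + j * m < N * m" by blast
        have "real (Suc (r + j * m)) / real (N * m) \<le> 1"
          using 1 K by (simp add: field_simps flip: of_nat_mult of_nat_add of_nat_Suc)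
        then show "0 \<le> real (r + j * m) / real (N * m) \<and> real (r + j * m) / real (N * m) \<le> \<tau> (r + j * m)
          \<and> \<tau> (r + j * m) \<le> 1"
          using \<tau>[OF 1] by auto
      next
        fix r r' assume r: "r < m" "r' < m" "r < r'"
        have "\<tau> (r + j * m) \<le> real (Suc (r + j * m)) / real (N * m)" using \<tau> lt r by blast
        also have "\<dots> \<le> real (r' + j * m) / real (N * m)"
          using r K by (intro divide_right_mono) auto
        finally show "{real (r + j * m) / real (N * m)<..<\<tau> (r + j * m)} \<inter>
           {real (r' + j * m) / real (N * m)<..<\<tau> (r' + j * m)} = {}" by auto
      next
        have "(\<Sum>r<m. \<tau> (r + j * m) - real (r + j * m) / real (N * m)) \<le> (\<Sum>r<m. 1 / real (N * m))"
        proof (rule sum_mono)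
          fix r assume "r \<in> {..<m}"
          then have "\<tau> (r + j * m) \<le> real (Suc (r + j * m)) / real (N * m)" using \<tau> lt by blast
          then show "\<tau> (r + j * m) - real (r + j * m) / real (N * m) \<le> 1 / real (N * m)"
            by (simp add: add_divide_distrib)
        qed
        also have "\<dots> = 1 / real N" using m by simp
        finally show "(\<Sum>r<m. \<tau> (r + j * m) - real (r + j * m) / real (N * m)) < \<delta>" using N by simp
      qed
      finally show ?thesis by simp
    qed
    have "sum ?f {..<N * m} = (\<Sum>j<N. sum ?f {j * m..<j * m + m})"
      by (rule sum.nat_group[symmetric])
    also have "\<dots> \<le> (\<Sum>j<N. 1)" using block by (intro sum_mono) auto
    finally show "sum ?f {..<N * m} \<le> real N" by simp
  qed
qed

lemma unit_interval_subdivision: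
  fixes t :: real
  assumes "t \<in> {0..1}" "K > 0"
  obtains i where "i < K" "real i / real K \<le> t" "t \<le> real (Suc i) / real K"
proof (cases "t = 1")
  case True
  then show ?thesis using assms that[of "K - 1"] by (auto simp: field_simps)
next
  case False
  have K: "real K > 0" using assms by simp
  define i where "i = nat \<lfloor>t * real K\<rfloor>"
  have 0: "0 \<le> t * real K" using assms by simp
  have i: "real i \<le> t * real K" "t * real K < real i + 1"
    unfolding i_def using 0 by linarith+
  have "t * real K < real K" using False assms K by simp
  then have "i < K" using i by linarith
  then show ?thesis
    using i K that[of i] by (simp add: field_simps)
qed

text \<open>The image is covered by disks around the nodes. The radii add up to at most
  \<open>N\<close> and each of them is at most \<open>\<eta>\<close>, so the total area is at most
  \<open>pi * \<eta> * N\<close>.\<close>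

lemma negligible_path_image:
  fixes g :: "real \<Rightarrow> complex"
  assumes ac: "abs_continuous_on_interval 0 1 g"
  shows "negligible (path_image g)"
  unfolding negligible_outer_le
proof (intro allI impI)
  fix e :: real assume "e > 0"
  obtain N :: nat where N: "N > 0"
    "\<And>m \<tau>. m > 0 \<Longrightarrow> (\<And>i. i < N * m \<Longrightarrow> real i / real (N * m) \<le> \<tau> i \<and> \<tau> i \<le> real (Suc i) / real (N * m)) \<Longrightarrow>
      (\<Sum>i<N * m. dist (g (real i / real (N * m))) (g (\<tau> i))) \<le> real N"
    using abs_continuous_bounded_variation[OF ac] by blast
  \<comment> \<open>Makes the total area bound \<open>pi * \<eta> * real N\<close> equal to
    \<open>e\<close>.\<close>
  define \<eta> where "\<eta> = e / (pi * real N)"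
  have "\<eta> > 0" using \<open>e > 0\<close> N by (simp add: \<eta>_def)
  obtain \<delta> where "\<delta> > 0"
    and \<delta>: "\<And>x y. x \<in> {0..1} \<Longrightarrow> y \<in> {0..1} \<Longrightarrow> \<bar>x - y\<bar> < \<delta> \<Longrightarrow> dist (g x) (g y) < \<eta>"
    using abs_continuous_uniform[OF ac \<open>\<eta> > 0\<close>] by metis
  obtain m :: nat where m: "m > 0" "1 / real m < \<delta>"
    using \<open>\<delta> > 0\<close> by (metis nat_approx_posE of_nat_Suc zero_less_Suc)
  define K where "K = N * m"
  have K: "K > 0" "1 / real K < \<delta>"
  proof -
    show "K > 0" using N m by (simp add: K_def)
    have "1 / real K \<le> 1 / real m" using N m by (simp add: K_def field_simps)
    with m show "1 / real K < \<delta>" by simp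
  qed
  let ?I = "\<lambda>i. {real i / real K..real (Suc i) / real K}"
  have I01: "?I i \<subseteq> {0..1}" if "i < K" for i
  proof -
    have "real (Suc i) / real K \<le> 1" using that by (simp add: field_simps)
    then show ?thesis by auto
  qed
  have cont: "continuous_on {0..1} g" using abs_continuous_imp_path[OF ac] by (simp add: path_def)
  \<comment> \<open>The radius is the distance to a farthest point of the arc; since it is attained,
    the sum of the radii is one of the sums bounded by \<open>N\<close>.\<close>
  have "\<exists>\<tau>\<in>?I i. \<forall>t\<in>?I i. dist (g (real i / real K)) (g t) \<le> dist (g (real i / real K)) (g \<tau>)"
    if "i < K" for i
    using I01[OF that] continuous_on_subset[OF cont I01[OF that]]
    by (intro continuous_attains_sup continuous_intros) (auto simp: divide_right_mono)
  then obtain \<tau> where \<tau>: "\<And>i. i < K \<Longrightarrow> \<tau> i \<in> ?I i"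
    and max: "\<And>i t. i < K \<Longrightarrow> t \<in> ?I i \<Longrightarrow>
      dist (g (real i / real K)) (g t) \<le> dist (g (real i / real K)) (g (\<tau> i))"
    by metis
  define r where "r i = dist (g (real i / real K)) (g (\<tau> i))" for i
  have r: "0 \<le> r i" "r i \<le> \<eta>" if "i < K" for i
  proof -
    have "real i / real K \<in> {0..1}" using that by simp
    moreover have "\<tau> i \<in> {0..1}" using I01[OF that] \<tau>[OF that] by blast
    moreover have "\<bar>real i / real K - \<tau> i\<bar> \<le> 1 / real K"
      using \<tau>[OF that] by (auto simp: add_divide_distrib)
    ultimately show "r i \<le> \<eta>"
      using \<delta>[of "real i / real K" "\<tau> i"] K(2) unfolding r_def by linarith
  qed (simp add: r_def)
  let ?T = "\<Union>i<K. cball (g (real i / real K)) (r i)"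
  have "path_image g \<subseteq> ?T"
  proof
    fix z assume "z \<in> path_image g"
    then obtain t where t: "t \<in> {0..1}" "z = g t" by (auto simp: path_image_def)
    then obtain i where i: "i < K" "real i / real K \<le> t" "t \<le> real (Suc i) / real K"
      using unit_interval_subdivision K by metis
    then show "z \<in> ?T" using max[of i t] t by (auto simp: r_def)
  qed
  moreover have "?T \<in> lmeasurable" by (intro fmeasurable.finite_UN) auto
  moreover have "measure lebesgue ?T \<le> e"
  proof -
    have "measure lebesgue ?T \<le> (\<Sum>i<K. measure lebesgue (cball (g (real i / real K)) (r i)))"
      by (intro measure_UNION_le) auto
    also have "\<dots> = (\<Sum>i<K. pi * (r i)\<^sup>2)"
      using r by (intro sum.cong refl) (simp add: content_cball unit_ball_vol_2)
    also have "\<dots> \<le> (\<Sum>i<K. pi * \<eta> * r i)"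
      using r by (intro sum_mono) (auto simp: power2_eq_square intro!: mult_right_mono)
    also have "\<dots> = pi * \<eta> * (\<Sum>i<K. r i)" by (simp add: sum_distrib_left)
    also have "\<dots> \<le> pi * \<eta> * real N"
      using N(2)[of m \<tau>] m \<tau> \<open>\<eta> > 0\<close> unfolding r_def K_def by (intro mult_left_mono) auto
    also have "\<dots> = e" using N by (simp add: \<eta>_def)
    finally show ?thesis .
  qed
  ultimately show "\<exists>T. path_image g \<subseteq> T \<and> T \<in> lmeasurable \<and> measure lebesgue T \<le> e" by blast
qed

section \<open>Area and centroid of triangles\<close>

text \<open>A closed set is Borel, so being null passes from the completed measure to
  \<open>lborel\<close>.\<close>

lemma negligible_closed_imp_AE_lborel:
  fixes S :: "'a::euclidean_space set"
  assumes "negligible S" "closed S"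
  shows "AE z in lborel. z \<notin> S"
proof -
  have "S \<in> null_sets lborel"
    using assms by (simp add: negligible_iff_null_sets null_sets_completion_iff)
  then show ?thesis by (rule AE_not_in)
qed

lemma AE_notin_path_image:
  fixes g :: "real \<Rightarrow> complex"
  assumes "abs_continuous_on_interval 0 1 g"
  shows "AE z in lborel. z \<notin> path_image g"
  using assms negligible_path_image abs_continuous_imp_path closed_path_image
  by (intro negligible_closed_imp_AE_lborel) blast+

lemma AE_notin_closed_segment: "AE z in lborel. z \<notin> closed_segment (a::complex) b"
  using AE_notin_path_image[OF abs_continuous_linepath[of a b]] by simp

text \<open>Change of variables with Jacobian \<open>c\<^sup>2\<close>, positive for either sign of
  \<open>c\<close>; hence \<open>c = -1\<close> also gives the invariance under point
  reflections.\<close>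

lemma
  fixes f :: "complex \<Rightarrow> real"
  assumes [measurable]: "f \<in> borel_measurable borel" and c: "c \<noteq> 0"
  shows integral_lborel_affine: "(\<integral>z. f (t + c *\<^sub>R z) \<partial>lborel) = (\<integral>z. f z \<partial>lborel) / c\<^sup>2"
    and integrable_lborel_affine: "integrable lborel f \<Longrightarrow> integrable lborel (\<lambda>z. f (t + c *\<^sub>R z))"
proof -
  have L: "lborel = density (distr lborel borel (\<lambda>x::complex. t + c *\<^sub>R x)) (\<lambda>_. ennreal (c\<^sup>2))"
    using lborel_affine[OF c, of t] by (simp add: ennreal_power)
  have "(\<integral>z. f z \<partial>lborel) = (\<integral>z. f z \<partial>density (distr lborel borel (\<lambda>x::complex. t + c *\<^sub>R x)) (\<lambda>_. ennreal (c\<^sup>2)))"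
    using L by simp
  also have "\<dots> = c\<^sup>2 * (\<integral>z. f (t + c *\<^sub>R z) \<partial>lborel)"
    by (simp add: integral_density integral_distr)
  finally show "(\<integral>z. f (t + c *\<^sub>R z) \<partial>lborel) = (\<integral>z. f z \<partial>lborel) / c\<^sup>2"
    using c by simp
  assume "integrable lborel f"
  then have "integrable (density (distr lborel borel (\<lambda>x::complex. t + c *\<^sub>R x)) (\<lambda>_. ennreal (c\<^sup>2))) f"
    using L by simp
  then show "integrable lborel (\<lambda>z. f (t + c *\<^sub>R z))"
    using c by (simp add: integrable_density integrable_distr_eq)
qed

lemma has_bochner_integral_lborel_affine:
  fixes f :: "complex \<Rightarrow> real"
  assumes "has_bochner_integral lborel f I" and c: "c \<noteq> 0"
  shows "has_bochner_integral lborel (\<lambda>z. f (t + c *\<^sub>R z)) (I / c\<^sup>2)"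
proof -
  have "f \<in> borel_measurable borel" "integrable lborel f" "(\<integral>z. f z \<partial>lborel) = I"
    using assms(1) borel_measurable_integrable by (auto simp: has_bochner_integral_iff)
  then show ?thesis
    using integral_lborel_affine[of f c t] integrable_lborel_affine[of f c t] c
    by (simp add: has_bochner_integral_iff)
qed

lemma has_bochner_integral_translate:
  fixes f :: "complex \<Rightarrow> real"
  assumes "has_bochner_integral lborel f I"
  shows "has_bochner_integral lborel (\<lambda>z. f (z - t)) I"
  using has_bochner_integral_lborel_affine[OF assms, of 1 "- t"] by simp

lemma has_bochner_integral_reflect:
  fixes f :: "complex \<Rightarrow> real"
  assumes "has_bochner_integral lborel f I"
  shows "has_bochner_integral lborel (\<lambda>z. f (t - z)) I"
  using has_bochner_integral_lborel_affine[OF assms, of "-1" t] by simp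

text \<open>Twice the signed area of the triangle with vertices \<open>0\<close>, \<open>p\<close>,
  \<open>r\<close>.\<close>

definition det2 :: "complex \<Rightarrow> complex \<Rightarrow> real" where
  "det2 p r = Re p * Im r - Im p * Re r"

text \<open>Subtracting \<open>p\<close> from \<open>r\<close> leaves the determinant unchanged. A
  thin triangle with apex \<open>0\<close> therefore has area at most proportional to its outer
  edge, which bounds sums of such areas by the length of a path.\<close>

lemma abs_det2_le: "\<bar>det2 p r\<bar> \<le> norm p * norm (r - p)"
proof -
  have "det2 p r = Im (cnj p * (r - p))" by (simp add: det2_def algebra_simps)
  then show ?thesis by (metis abs_Im_le_cmod complex_mod_cnj norm_mult)
qed

text \<open>Transports \<open>content_triangle\<close> from \<open>real^2\<close> to the complex
  plane.\<close>

lemma lborel_complex_eq_distr: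
  "lborel = distr lborel borel (\<lambda>v::real^2. Complex (v $ 1) (v $ 2))"
proof (rule lborel_eqI)
  let ?\<phi> = "\<lambda>v::real^2. Complex (v $ 1) (v $ 2)"
  have [measurable]: "?\<phi> \<in> borel_measurable borel"
    unfolding Complex_eq by (intro borel_measurable_continuous_onI continuous_intros)
  fix l u :: complex assume le: "\<And>b. b \<in> Basis \<Longrightarrow> l \<bullet> b \<le> u \<bullet> b"
  then have le': "Re l \<le> Re u" "Im l \<le> Im u"
    using le[of 1] le[of \<i>] by (auto simp: Basis_complex_def)
  let ?l = "vector [Re l, Im l] :: real^2" and ?u = "vector [Re u, Im u] :: real^2"
  have "emeasure (distr lborel borel ?\<phi>) (box l u) = emeasure lborel (?\<phi> -` box l u)"
    by (subst emeasure_distr) auto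
  also have "?\<phi> -` box l u = box ?l ?u"
    by (auto simp: box_def Basis_complex_def Basis_vec_def inner_axis forall_2)
  also have "emeasure lborel (box ?l ?u) = ennreal (\<Prod>b\<in>Basis. (?u - ?l) \<bullet> b)"
  proof (rule emeasure_lborel_box)
    have "?l $ i \<le> ?u $ i" for i using exhaust_2[of i] le' by auto
    then show "?l \<bullet> b \<le> ?u \<bullet> b" if "b \<in> Basis" for b
      using that by (auto simp: Basis_vec_def inner_axis)
  qed
  also have "(\<Prod>b\<in>Basis. (?u - ?l) \<bullet> b) = (Re u - Re l) * (Im u - Im l)"
  proof -
    have B: "(Basis :: (real^2) set) = {axis 1 1, axis 2 1}"
      by (auto simp: Basis_vec_def exhaust_2) (metis exhaust_2)
    have "axis 1 1 \<noteq> (axis 2 1 :: real^2)" by (simp add: axis_eq_axis)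
    then show ?thesis unfolding B by (simp add: inner_axis)
  qed
  also have "\<dots> = (\<Prod>b\<in>Basis. (u - l) \<bullet> b)" by (simp add: Basis_complex_def)
  finally show "emeasure (distr lborel borel ?\<phi>) (box l u) = (\<Prod>b\<in>Basis. (u - l) \<bullet> b)" .
qed simp

lemma compact_triangle: "compact (convex hull {a, b, c :: 'a :: euclidean_space})"
  by (intro finite_imp_compact_convex_hull) auto

lemma borel_triangle [measurable]: "convex hull {a, b, c :: 'a :: euclidean_space} \<in> sets borel"
  by (rule borel_closed[OF compact_imp_closed[OF compact_triangle]])

lemma content_triangle_complex:
  "measure lborel (convex hull {0, p, r :: complex}) = \<bar>det2 p r\<bar> / 2"
proof -
  let ?\<phi> = "\<lambda>v::real^2. Complex (v $ 1) (v $ 2)"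
  let ?\<psi> = "\<lambda>z. vector [Re z, Im z] :: real^2"
  have [measurable]: "?\<phi> \<in> borel_measurable borel"
    unfolding Complex_eq by (intro borel_measurable_continuous_onI continuous_intros)
  have lin: "linear ?\<psi>"
    by (intro linearI) (auto simp: vec_eq_iff forall_2)
  have "measure lborel (convex hull {0, p, r}) = measure lborel (?\<phi> -` (convex hull {0, p, r}))"
    by (subst lborel_complex_eq_distr) (simp add: measure_distr)
  also have "?\<phi> -` (convex hull {0, p, r}) = ?\<psi> ` (convex hull {0, p, r})"
  proof -
    have 1: "?\<psi> (?\<phi> v) = v" and 2: "?\<phi> (?\<psi> z) = z" for v z
      by (auto simp: vec_eq_iff forall_2)
    show ?thesis
    proof (intro equalityI subsetI)
      fix v assume "v \<in> ?\<phi> -` (convex hull {0, p, r})"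
      then show "v \<in> ?\<psi> ` (convex hull {0, p, r})" by (auto intro!: image_eqI[of v ?\<psi>, OF 1[of v, symmetric]])
    next
      fix v assume "v \<in> ?\<psi> ` (convex hull {0, p, r})"
      then show "v \<in> ?\<phi> -` (convex hull {0, p, r})" by (auto simp: 2)
    qed
  qed
  also have "\<dots> = convex hull (?\<psi> ` {0, p, r})"
    by (rule convex_hull_linear_image[OF lin])
  also have "?\<psi> ` {0, p, r} = {?\<psi> 0, ?\<psi> p, ?\<psi> r}" by simp
  also have "measure lborel (convex hull {?\<psi> 0, ?\<psi> p, ?\<psi> r}) = \<bar>det2 p r\<bar> / 2"
    by (subst content_triangle) (simp add: det2_def algebra_simps abs_minus_commute)
  finally show ?thesis .
qed

text \<open>Setting the winding number to $0$ on the image makes it a Borel function that obeys the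
  additivity laws of winding numbers almost everywhere.\<close>

definition winding_off :: "(real \<Rightarrow> complex) \<Rightarrow> complex \<Rightarrow> real" where
  "winding_off \<gamma> z = (if z \<in> path_image \<gamma> then 0 else Re (winding_number \<gamma> z))"

text \<open>Off the image, which is closed, the winding number is continuous.\<close>

lemma borel_measurable_winding_off [measurable (raw)]:
  assumes "path \<gamma>"
  shows "winding_off \<gamma> \<in> borel_measurable borel"
proof -
  have "continuous_on (- path_image \<gamma>) (\<lambda>z. Re (winding_number \<gamma> z))"
    by (intro continuous_intros continuous_at_imp_continuous_on ballI
      continuous_at_winding_number assms) auto
  then have "(\<lambda>z. indicator (- path_image \<gamma>) z *\<^sub>R Re (winding_number \<gamma> z)) \<in> borel_measurable borel"
    using closed_path_image[OF assms] by (intro borel_measurable_continuous_on_indicator) auto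
  moreover have "(\<lambda>z. indicator (- path_image \<gamma>) z *\<^sub>R Re (winding_number \<gamma> z)) = winding_off \<gamma>"
    by (auto simp: winding_off_def indicator_def fun_eq_iff)
  ultimately show ?thesis by simp
qed

section \<open>Winding functions of segments and triangles\<close>

text \<open>For an open path the winding number is a complex number. Its real part is the signed
  angle, in full turns, under which the segment is seen from the point.\<close>

abbreviation edge :: "complex \<Rightarrow> complex \<Rightarrow> complex \<Rightarrow> real" where
  "edge a b \<equiv> winding_off (linepath a b)"

text \<open>The factor \<open>k\<close> cancels in the integrand
  \<open>dw / (w - z)\<close>.\<close>

lemma winding_number_linepath_affine:
  fixes a b c k z :: complex
  assumes "k \<noteq> 0" "z \<notin> closed_segment a b"
  shows "winding_number (linepath (c + k * a) (c + k * b)) (c + k * z) = winding_number (linepath a b) z"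
proof -
  let ?I = "2 * pi * \<i> * winding_number (linepath a b) z"
  have L: "linepath (c + k * a) (c + k * b) t - (c + k * z) = k * (linepath a b t - z)" for t
    by (simp add: linepath_def algebra_simps scaleR_conv_of_real)
  have "((\<lambda>w. 1 / (w - z)) has_contour_integral ?I) (linepath a b)"
    using assms by (intro has_contour_integral_winding_number) auto
  then have "((\<lambda>t. 1 / (linepath a b t - z) * (b - a)) has_integral ?I) {0..1}"
    by (simp add: has_contour_integral_linepath)
  moreover have "1 / (linepath (c + k * a) (c + k * b) t - (c + k * z)) * ((c + k * b) - (c + k * a))
      = 1 / (linepath a b t - z) * (b - a)" for t
  proof -
    have "c + k * b - (c + k * a) = k * (b - a)" by (simp add: algebra_simps)
    then show ?thesis unfolding L using assms(1) by simp
  qed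
  ultimately have *: "((\<lambda>w. 1 / (w - (c + k * z))) has_contour_integral ?I) (linepath (c + k * a) (c + k * b))"
    by (simp add: has_contour_integral_linepath)
  have "c + k * z \<notin> path_image (linepath (c + k * a) (c + k * b))"
  proof
    assume "c + k * z \<in> path_image (linepath (c + k * a) (c + k * b))"
    then obtain t where "t \<in> {0..1}" "c + k * z = linepath (c + k * a) (c + k * b) t"
      by (auto simp: path_image_def)
    then have "z = linepath a b t" using L[of t] assms(1) by simp
    with \<open>t \<in> {0..1}\<close> assms(2) show False
      by (metis imageI path_image_def path_image_linepath)
  qed
  then have "((\<lambda>w. 1 / (w - (c + k * z))) has_contour_integral
    (2 * pi * \<i> * winding_number (linepath (c + k * a) (c + k * b)) (c + k * z))) (linepath (c + k * a) (c + k * b))"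
    by (intro has_contour_integral_winding_number) auto
  from has_contour_integral_unique[OF this *] show ?thesis by simp
qed

lemma edge_affine:
  assumes "k \<noteq> 0"
  shows "edge (c + k * a) (c + k * b) (c + k * z) = edge a b z"
proof -
  have "c + k * z \<in> closed_segment (c + k * a) (c + k * b) \<longleftrightarrow> z \<in> closed_segment a b"
  proof -
    have "c + k * z = (1 - u) *\<^sub>R (c + k * a) + u *\<^sub>R (c + k * b) \<longleftrightarrow> z = (1 - u) *\<^sub>R a + u *\<^sub>R b" for u
    proof -
      have "(1 - u) *\<^sub>R (c + k * a) + u *\<^sub>R (c + k * b) = c + k * ((1 - u) *\<^sub>R a + u *\<^sub>R b)"
        by (simp add: algebra_simps scaleR_conv_of_real)
      then show ?thesis using assms by simp
    qed
    then show ?thesis by (auto simp: closed_segment_def)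
  qed
  then show ?thesis
    using winding_number_linepath_affine[OF assms, of z a b c] by (auto simp: winding_off_def)
qed

lemma edge_reverse: "edge b a z = - edge a b z"
  using winding_number_reversepath[of "linepath a b" z]
  by (auto simp: winding_off_def closed_segment_commute)

lemma edge_refl [simp]: "edge a a z = 0"
  by (simp add: winding_off_def)

lemma edge_split:
  assumes "c \<in> closed_segment a b" "z \<notin> closed_segment a b"
  shows "edge a b z = edge a c z + edge c b z"
proof -
  have "closed_segment a c \<subseteq> closed_segment a b" "closed_segment c b \<subseteq> closed_segment a b"
    using assms(1) by (simp_all add: subset_closed_segment)
  then show ?thesis
    using winding_number_split_linepath[OF assms] assms(2) by (auto simp: winding_off_def)
qed

text \<open>Keeping the boundary as a sum of three edges turns subdivisions into cancellations of
  opposite edges.\<close>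

definition tri :: "complex \<Rightarrow> complex \<Rightarrow> complex \<Rightarrow> complex \<Rightarrow> real" where
  "tri a b c z = edge a b z + edge b c z + edge c a z"

lemma borel_measurable_tri [measurable]: "tri a b c \<in> borel_measurable borel"
  unfolding tri_def by measurable

lemma tri_affine:
  assumes "k \<noteq> 0"
  shows "tri (c + k * a1) (c + k * a2) (c + k * a3) (c + k * z) = tri a1 a2 a3 z"
  using edge_affine[OF assms] by (simp add: tri_def)

text \<open>Outside the hull the boundary does not wind around the point, in the interior it winds
  once in the direction given by the orientation, and the frontier is a null set. A degenerate
  triangle has empty interior, in accordance with \<open>sgn 0 = 0\<close>.\<close>

lemma tri_eq_sgn_indicator:
  "AE z in lborel. tri 0 p r z = sgn (det2 p r) * indicator (convex hull {0, p, r}) z"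
proof -
  let ?S = "convex hull {0, p, r}"
  have "AE z in lborel. z \<notin> frontier ?S"
    by (intro negligible_closed_imp_AE_lborel negligible_convex_frontier) auto
  then show ?thesis
    using AE_notin_closed_segment[of 0 p] AE_notin_closed_segment[of p r] AE_notin_closed_segment[of r 0]
  proof eventually_elim
    case (elim z)
    let ?\<gamma> = "linepath 0 p +++ linepath p r +++ linepath r 0"
    have tri: "tri 0 p r z = Re (winding_number ?\<gamma> z)"
      using elim by (simp add: tri_def winding_off_def winding_number_join not_in_path_image_join)
    show ?case
    proof (cases "z \<in> ?S")
      case False
      have "path_image ?\<gamma> \<subseteq> ?S"
        by (simp add: path_image_join segment_convex_hull hull_mono)
      then have "winding_number ?\<gamma> z = 0"
        using False by (intro winding_number_zero_outside[of _ ?S]) auto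
      then show ?thesis using tri False by simp
    next
      case True
      then have int: "z \<in> interior ?S"
        using elim(1) closure_subset by (auto simp: frontier_def)
      obtain u v w where z: "0 \<le> u" "0 \<le> v" "0 \<le> w" "z = u *\<^sub>R 0 + v *\<^sub>R p + w *\<^sub>R r"
        using True by (auto simp: convex_hull_3)
      \<comment> \<open>The quantity whose sign decides the winding number is the barycentric
        coordinate \<open>w\<close> of \<open>r\<close> times the determinant.\<close>
      have w: "Im ((p - 0) * cnj (p - z)) = w * det2 p r"
        unfolding z det2_def by (simp add: algebra_simps)
      have "w * det2 p r \<noteq> 0" using wn_triangle2[OF int] w by auto
      then have "0 < w" "det2 p r \<noteq> 0" using z(3) by auto
      then have "0 < w * det2 p r \<longleftrightarrow> 0 < det2 p r" by (simp add: zero_less_mult_iff)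
      then have "Re (winding_number ?\<gamma> z) = sgn (det2 p r)"
        unfolding winding_number_triangle[OF int] w using \<open>det2 p r \<noteq> 0\<close> by (auto simp: sgn_if)
      then show ?thesis using tri True by simp
    qed
  qed
qed

lemma emeasure_triangle: "emeasure lborel (convex hull {0, p, r}) = ennreal (\<bar>det2 p r\<bar> / 2)"
proof -
  have "emeasure lborel (convex hull {0, p, r}) < \<infinity>"
    using compact_triangle[of 0 p r] by (intro emeasure_bounded_finite compact_imp_bounded)
  then show ?thesis
    using emeasure_eq_ennreal_measure[of lborel "convex hull {0, p, r}"]
    unfolding content_triangle_complex by simp
qed

lemma nn_integral_abs_tri: "(\<integral>\<^sup>+z. ennreal \<bar>tri 0 p r z\<bar> \<partial>lborel) \<le> ennreal (\<bar>det2 p r\<bar> / 2)"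
proof -
  let ?S = "convex hull {0, p, r}"
  have "(\<integral>\<^sup>+z. ennreal \<bar>tri 0 p r z\<bar> \<partial>lborel) \<le> (\<integral>\<^sup>+z. indicator ?S z \<partial>lborel)"
  proof (rule nn_integral_mono_AE)
    show "AE z in lborel. ennreal \<bar>tri 0 p r z\<bar> \<le> indicator ?S z"
      using tri_eq_sgn_indicator[of p r]
      by eventually_elim (auto simp: indicator_def sgn_if)
  qed
  also have "\<dots> = ennreal (\<bar>det2 p r\<bar> / 2)"
    by (simp add: emeasure_triangle)
  finally show ?thesis .
qed

lemma has_integral_tri: "has_bochner_integral lborel (tri 0 p r) (det2 p r / 2)"
proof -
  let ?S = "convex hull {0, p, r}"
  have "has_bochner_integral lborel (indicator ?S) (measure lborel ?S)"
    using emeasure_triangle[of p r] by (intro has_bochner_integral_real_indicator) auto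
  then have "has_bochner_integral lborel (\<lambda>z. sgn (det2 p r) * indicator ?S z) (sgn (det2 p r) * (\<bar>det2 p r\<bar> / 2))"
    unfolding content_triangle_complex by (intro has_bochner_integral_mult_right)
  moreover have "sgn (det2 p r) * (\<bar>det2 p r\<bar> / 2) = det2 p r / 2"
    by (simp add: sgn_if)
  ultimately show ?thesis
    using tri_eq_sgn_indicator[of p r]
    by (subst has_bochner_integral_cong_AE[of _ _ "\<lambda>z. sgn (det2 p r) * indicator ?S z"]) auto
qed

lemma integrable_y_tri: "integrable lborel (\<lambda>z. Im z * tri 0 p r z)"
proof -
  let ?S = "convex hull {0, p, r}"
  have "integrable lborel (\<lambda>z. indicator ?S z *\<^sub>R (sgn (det2 p r) * Im z))"
    by (intro borel_integrable_compact compact_triangle continuous_intros)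
  then show ?thesis
  proof (rule integrable_cong_AE_imp)
    show "AE z in lborel. indicator ?S z *\<^sub>R (sgn (det2 p r) * Im z) = Im z * tri 0 p r z"
      using tri_eq_sgn_indicator[of p r] by eventually_elim simp
  qed measurable
qed

text \<open>The midpoints \<open>p\<close>, \<open>p + r\<close>, \<open>r\<close> of the sides cut
  the doubled triangle into three translates of the original one and a point reflection of it in the
  middle. The inner edges cancel.\<close>

lemma tri_midpoints:
  "AE z in lborel. tri 0 (2 * p) (2 * r) z =
     tri 0 p r z + tri 0 p r (z - p) + tri 0 p r (z - r) + tri 0 p r (p + r - z)"
  using AE_notin_closed_segment[of 0 "2 * p"] AE_notin_closed_segment[of "2 * p" "2 * r"]
    AE_notin_closed_segment[of "2 * r" 0]
proof eventually_elim
  case (elim z)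
  have mid: "p \<in> closed_segment 0 (2 * p)" "p + r \<in> closed_segment (2 * p) (2 * r)"
    "r \<in> closed_segment (2 * r) 0"
    unfolding closed_segment_def by (auto intro!: exI[of _ "1/2"] simp: scaleR_conv_of_real)
  have "tri 0 p r (z - p) = tri p (2 * p) (p + r) z" "tri 0 p r (z - r) = tri r (p + r) (2 * r) z"
    using tri_affine[of 1 p 0 p r "z - p"] tri_affine[of 1 r 0 p r "z - r"]
    by (simp_all add: add.commute)
  moreover have "tri 0 p r (p + r - z) = tri (p + r) r p z"
    using tri_affine[of "-1" "p + r" 0 p r "p + r - z"] by simp
  ultimately show ?case
    using edge_split[OF mid(1) elim(1)] edge_split[OF mid(2) elim(2)] edge_split[OF mid(3) elim(3)]
      edge_reverse[of p "p + r" z] edge_reverse[of "p + r" r z] edge_reverse[of r p z]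
    by (simp add: tri_def)
qed

text \<open>The centroid of a triangle, from its subdivision into four half-size triangles: doubling
  multiplies the moment by $8$, whereas the four pieces contribute two copies of the moment and
  twice the area times the sum of the heights of the vertices.\<close>

lemma has_integral_y_tri:
  "has_bochner_integral lborel (\<lambda>z. Im z * tri 0 p r z) (det2 p r / 2 * (Im p + Im r) / 3)"
proof -
  define A where "A = det2 p r / 2"
  define F where "F = (\<integral>z. Im z * tri 0 p r z \<partial>lborel)"
  have T: "has_bochner_integral lborel (tri 0 p r) A"
    unfolding A_def by (rule has_integral_tri)
  have F: "has_bochner_integral lborel (\<lambda>z. Im z * tri 0 p r z) F"
    unfolding F_def using integrable_y_tri by (simp add: has_bochner_integral_iff)
  have shift: "has_bochner_integral lborel (\<lambda>z. Im z * tri 0 p r (z - t)) (F + Im t * A)" for t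
    using has_bochner_integral_translate[OF has_bochner_integral_add[OF F
      has_bochner_integral_mult_right[OF T, of "Im t"]], of t]
    by (simp add: algebra_simps)
  have reflect: "has_bochner_integral lborel (\<lambda>z. Im z * tri 0 p r (p + r - z)) (Im (p + r) * A - F)"
    using has_bochner_integral_reflect[OF has_bochner_integral_diff[OF
      has_bochner_integral_mult_right[OF T, of "Im (p + r)"] F], of "p + r"]
    by (simp add: algebra_simps)
  have "has_bochner_integral lborel (\<lambda>z. Im z * tri 0 (2 * p) (2 * r) z)
      (F + (F + Im p * A) + (F + Im r * A) + (Im (p + r) * A - F))"
    (is "has_bochner_integral lborel ?f ?I")
  proof (subst has_bochner_integral_cong_AE)
    show "AE z in lborel. ?f z = Im z * tri 0 p r z + Im z * tri 0 p r (z - p) +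
       Im z * tri 0 p r (z - r) + Im z * tri 0 p r (p + r - z)"
      using tri_midpoints[of p r] by eventually_elim (simp add: algebra_simps)
    show "has_bochner_integral lborel (\<lambda>z. Im z * tri 0 p r z + Im z * tri 0 p r (z - p) +
       Im z * tri 0 p r (z - r) + Im z * tri 0 p r (p + r - z)) ?I"
      by (intro has_bochner_integral_add F shift reflect)
  qed measurable
  from has_bochner_integral_lborel_affine[OF this, of 2 0]
  have "has_bochner_integral lborel (\<lambda>z. 2 * (Im z * tri 0 (2 * p) (2 * r) (2 * z))) (?I / 4)"
    by (simp add: scaleR_conv_of_real mult.assoc)
  moreover have "tri 0 (2 * p) (2 * r) (2 * z) = tri 0 p r z" for z
    using tri_affine[of 2 0 0 p r z] by simp
  ultimately have "has_bochner_integral lborel (\<lambda>z. 2 * (Im z * tri 0 p r z)) (?I / 4)" by simp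
  \<comment> \<open>Both sides are the integral of \<open>2 * (Im z * tri 0 p r z)\<close>; the
    equation reads \<open>2 * F + 2 * A * (Im p + Im r) = 8 * F\<close>.\<close>
  from has_bochner_integral_eq[OF this has_bochner_integral_mult_right[OF F, of 2]]
  have "?I / 4 = 2 * F" .
  then have "F = A * (Im p + Im r) / 3" by (simp add: algebra_simps)
  with F show ?thesis unfolding A_def by simp
qed

section \<open>Area and moment of a concatenation\<close>

lemma plane_pathsD:
  assumes "g \<in> plane_paths"
  shows "abs_continuous_on_interval 0 1 g" "g 0 = 0" "pathstart g = 0" "path g"
  using assms abs_continuous_imp_path by (auto simp: plane_paths_def pathstart_def)

section \<open>Approximation by fans of triangles\<close>

lemma winding_off_joinpaths:
  assumes "path g" "path h" "pathfinish g = pathstart h" "z \<notin> path_image g" "z \<notin> path_image h"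
  shows "winding_off (g +++ h) z = winding_off g z + winding_off h z"
  using assms by (simp add: winding_off_def winding_number_join not_in_path_image_join)

text \<open>On a fine mesh every chord stays closer to its arc than the arc does to
  \<open>z\<close>, so both have the same winding number, and the arcs add up to \<open>g\<close>.
  The edges through the apex \<open>0\<close> telescope to the closing edge.\<close>

lemma winding_off_eq_fan:
  fixes g :: "real \<Rightarrow> complex" and K :: nat
  defines "v \<equiv> \<lambda>i. g (real i / real K)"
  assumes g: "path g" "g 0 = 0" "z \<notin> path_image g" and K: "K > 0"
    and d: "\<And>t. t \<in> {0..1} \<Longrightarrow> d \<le> dist (g t) z"
    and mesh: "\<And>s t. s \<in> {0..1} \<Longrightarrow> t \<in> {0..1} \<Longrightarrow> \<bar>s - t\<bar> \<le> 1 / real K \<Longrightarrow> dist (g s) (g t) < d / 2"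
  shows "(\<Sum>i<K. tri 0 (v i) (v (Suc i)) z) = winding_off g z + edge (pathfinish g) 0 z"
proof -
  have node: "real i / real K \<in> {0..1}" if "i \<le> K" for i
    using that K by (auto simp: field_simps)
  have piece: "edge (v i) (v (Suc i)) z = Re (winding_number (subpath (real i / real K) (real (Suc i) / real K) g) z)"
    if "i < K" for i
  proof -
    let ?s = "real i / real K" and ?t = "real (Suc i) / real K"
    have st: "?s \<in> {0..1}" "?t \<in> {0..1}" using node[of i] node[of "Suc i"] that by auto
    have "?t - ?s = 1 / real K" by (simp add: add_divide_distrib)
    then have "\<bar>?s - ?t\<bar> \<le> 1 / real K"
      by (simp only: abs_minus_commute[of ?s ?t]) simp
    then have vv: "dist (v i) (v (Suc i)) < d / 2"
      using mesh[OF st] unfolding v_def by blast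
    have seg: "dist (v i) w < d / 2" if "w \<in> closed_segment (v i) (v (Suc i))" for w
      using that vv dist_in_closed_segment[of w "v i" "v (Suc i)"] by (simp add: dist_commute)
    have zseg: "z \<notin> closed_segment (v i) (v (Suc i))"
    proof
      assume "z \<in> closed_segment (v i) (v (Suc i))"
      then show False using seg[of z] d[OF st(1)] zero_le_dist[of "v i" z] unfolding v_def by simp
    qed
    have "winding_number (linepath (v i) (v (Suc i))) z = winding_number (subpath ?s ?t g) z"
    proof (rule winding_number_nearby_paths_eq)
      show "path (subpath ?s ?t g)" using g(1) st by simp
      fix u :: real assume u: "u \<in> {0..1}"
      define x where "x = (?t - ?s) * u + ?s"
      have x: "x \<in> {?s..?t}"
      proof -
        have "?s \<le> ?t" by (simp add: divide_right_mono)
        then have "0 \<le> (?t - ?s) * u" "(?t - ?s) * u \<le> (?t - ?s) * 1"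
          using u by (intro mult_nonneg_nonneg mult_left_mono; simp only: diff_ge_0_iff_ge atLeastAtMost_iff)+
        then show ?thesis unfolding x_def by simp
      qed
        then have x01: "x \<in> {0..1}" using st unfolding atLeastAtMost_iff by linarith
      have "\<bar>?s - x\<bar> \<le> 1 / real K" using x \<open>?t - ?s = 1 / real K\<close> by auto
      then have "dist (v i) (g x) < d / 2" using mesh[OF st(1) x01] unfolding v_def by simp
      moreover have "dist (v i) (linepath (v i) (v (Suc i)) u) < d / 2"
        using u by (intro seg) (metis imageI path_image_def path_image_linepath)
      ultimately have "dist (linepath (v i) (v (Suc i)) u) (g x) < d"
        by (metis dist_commute dist_triangle_half_r)
      also have "d \<le> dist (g x) z" by (rule d[OF x01])
      finally show "cmod (linepath (v i) (v (Suc i)) u - subpath ?s ?t g u) < cmod (subpath ?s ?t g u - z)"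
        unfolding subpath_def x_def by (simp add: dist_norm)
    qed (auto simp: v_def)
    then show ?thesis using zseg by (simp add: winding_off_def)
  qed
  have sub: "(\<Sum>i<j. winding_number (subpath (real i / real K) (real (Suc i) / real K) g) z)
      = winding_number (subpath 0 (real j / real K) g) z" if "j \<le> K" for j
    using that
  proof (induction j)
    case 0
    have "z \<noteq> g 0" using g(3) by (auto simp: path_image_def)
    then show ?case by simp
  next
    case (Suc j)
    then show ?case
      using winding_number_subpath_combine[OF g(1,3), of 0 "real j / real K" "real (Suc j) / real K"]
        node[of j] node[of "Suc j"] by simp
  qed
  have "(\<Sum>i<K. edge (v i) (v (Suc i)) z) = Re (\<Sum>i<K. winding_number (subpath (real i / real K) (real (Suc i) / real K) g) z)"
    by (simp add: piece)
  also have "\<dots> = winding_off g z"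
    using sub[of K] K g(3) by (simp add: winding_off_def)
  finally have edges: "(\<Sum>i<K. edge (v i) (v (Suc i)) z) = winding_off g z" .
  \<comment> \<open>Neighbouring triangles share a spoke with opposite orientations. The first spoke
    is trivial because \<open>g 0 = 0\<close>, and the last one is the closing segment.\<close>
  have "(\<Sum>i<K. tri 0 (v i) (v (Suc i)) z)
      = (\<Sum>i<K. edge (v i) (v (Suc i)) z) - (\<Sum>i<K. edge 0 (v (Suc i)) z - edge 0 (v i) z)"
    by (simp add: tri_def edge_reverse[of _ 0] flip: sum_subtractf)
       (simp add: sum.distrib sum_subtractf)
  also have "(\<Sum>i<K. edge 0 (v (Suc i)) z - edge 0 (v i) z) = edge 0 (v K) z - edge 0 (v 0) z"
    by (rule sum_lessThan_telescope)
  also have "edge 0 (v K) z - edge 0 (v 0) z = - edge (pathfinish g) 0 z"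
    using K g(2) by (simp add: v_def pathfinish_def edge_reverse[of "g 1"])
  finally show ?thesis using edges by simp
qed

text \<open>The numbers of nodes are positive multiples of \<open>N\<close>, to match the partitions
  on which the variation is bounded.\<close>

lemma winding_off_fan_eventually:
  assumes "g \<in> plane_paths" "z \<notin> path_image g" "N > 0"
  shows "\<forall>\<^sub>F m in sequentially.
    (\<Sum>i<N * Suc m. tri 0 (g (real i / real (N * Suc m))) (g (real (Suc i) / real (N * Suc m))) z)
      = winding_off g z + edge (pathfinish g) 0 z"
proof -
  note g = plane_pathsD[OF assms(1)]
  obtain d where d: "d > 0" "\<And>w. w \<in> path_image g \<Longrightarrow> d \<le> dist z w"
    using separate_point_closed[OF closed_path_image[OF g(4)] assms(2)] by blast
  have d': "d \<le> dist (g t) z" if "t \<in> {0..1}" for t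
    using d(2)[of "g t"] that by (auto simp: path_image_def dist_commute)
  obtain \<delta> where \<delta>: "\<delta> > 0" "\<And>x y. x \<in> {0..1} \<Longrightarrow> y \<in> {0..1} \<Longrightarrow> \<bar>x - y\<bar> < \<delta> \<Longrightarrow> dist (g x) (g y) < d / 2"
    using abs_continuous_uniform[OF g(1), of "d / 2"] d(1) by (metis half_gt_zero)
  have "\<forall>\<^sub>F m in sequentially. 1 / real (Suc m) < \<delta>"
    using LIMSEQ_inverse_real_of_nat \<delta>(1) by (auto simp: inverse_eq_divide dest: order_tendstoD(2))
  then show ?thesis
  proof eventually_elim
    case (elim m)
    have "1 / real (N * Suc m) \<le> 1 / real (Suc m)"
    proof (rule divide_left_mono)
      show "real (Suc m) \<le> real (N * Suc m)" unfolding of_nat_le_iff using assms(3) by (cases N) auto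
      show "0 < real (N * Suc m) * real (Suc m)"
        unfolding of_nat_mult using assms(3) by (intro mult_pos_pos) simp_all
    qed simp
    then show ?case
      using assms(3) elim
      by (intro winding_off_eq_fan[OF g(4,2) assms(2) _ d'] \<delta>(2)) auto
  qed
qed

text \<open>Fatou's lemma: almost everywhere the fan sums are eventually equal to this function, and
  their L1 norms are at most \<open>R * N / 2\<close>. The closing edge is included because the
  winding function of a path with distinct endpoints decays only like the inverse distance.\<close>

lemma integrable_winding_off:
  assumes "g \<in> plane_paths"
  shows "integrable lborel (\<lambda>z. winding_off g z + edge (pathfinish g) 0 z)"
proof -
  note g = plane_pathsD[OF assms]
  obtain N :: nat where N: "N > 0"
    "\<And>m \<tau>. m > 0 \<Longrightarrow> (\<And>i. i < N * m \<Longrightarrow> real i / real (N * m) \<le> \<tau> i \<and> \<tau> i \<le> real (Suc i) / real (N * m)) \<Longrightarrow>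
      (\<Sum>i<N * m. dist (g (real i / real (N * m))) (g (\<tau> i))) \<le> real N"
    using abs_continuous_bounded_variation[OF g(1)] by blast
  obtain R where R: "R > 0" "\<And>w. w \<in> path_image g \<Longrightarrow> norm w \<le> R"
    using bounded_path_image[OF g(4)] bounded_pos by blast
  let ?W = "\<lambda>z. winding_off g z + edge (pathfinish g) 0 z"
  define v where "v m i = g (real i / real (N * Suc m))" for m i
  define f where "f m z = (\<Sum>i<N * Suc m. tri 0 (v m i) (v m (Suc i)) z)" for m z
  have [measurable]: "?W \<in> borel_measurable borel"
    using g(4) by measurable
  have [measurable]: "f m \<in> borel_measurable borel" for m
    unfolding f_def by measurable
  have bound: "(\<integral>\<^sup>+z. ennreal \<bar>f m z\<bar> \<partial>lborel) \<le> ennreal (R * real N / 2)" for m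
  proof -
    have v: "norm (v m i) \<le> R" if "i < N * Suc m" for i
    proof -
      have "real i \<le> real (N * Suc m)" using that by (simp only: of_nat_le_iff)
      then have "real i / real (N * Suc m) \<in> {0..1}"
        by (auto simp: divide_le_eq_1 simp del: of_nat_mult)
      then show ?thesis unfolding v_def by (intro R) (auto simp: path_image_def)
    qed
    have "(\<integral>\<^sup>+z. ennreal \<bar>f m z\<bar> \<partial>lborel)
        \<le> (\<integral>\<^sup>+z. (\<Sum>i<N * Suc m. ennreal \<bar>tri 0 (v m i) (v m (Suc i)) z\<bar>) \<partial>lborel)"
      unfolding f_def by (intro nn_integral_mono) (simp add: sum_ennreal ennreal_leI sum_abs)
    also have "\<dots> = (\<Sum>i<N * Suc m. \<integral>\<^sup>+z. ennreal \<bar>tri 0 (v m i) (v m (Suc i)) z\<bar> \<partial>lborel)"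
      by (rule nn_integral_sum) measurable
    also have "\<dots> \<le> (\<Sum>i<N * Suc m. ennreal (R * dist (v m i) (v m (Suc i)) / 2))"
    proof (rule sum_mono)
      fix i assume i: "i \<in> {..<N * Suc m}"
      have "\<bar>det2 (v m i) (v m (Suc i))\<bar> \<le> norm (v m i) * norm (v m (Suc i) - v m i)"
        by (rule abs_det2_le)
      also have "\<dots> \<le> R * dist (v m i) (v m (Suc i))"
        using v[of i] i by (simp add: dist_norm norm_minus_commute mult_right_mono)
      finally show "(\<integral>\<^sup>+z. ennreal \<bar>tri 0 (v m i) (v m (Suc i)) z\<bar> \<partial>lborel)
          \<le> ennreal (R * dist (v m i) (v m (Suc i)) / 2)"
        using nn_integral_abs_tri[of "v m i" "v m (Suc i)"] by (meson divide_right_mono ennreal_leI order_trans zero_le_numeral)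
    qed
    also have "\<dots> = ennreal (R / 2 * (\<Sum>i<N * Suc m. dist (v m i) (v m (Suc i))))"
      using R(1) by (simp add: sum_ennreal sum_distrib_left)
    also have "\<dots> \<le> ennreal (R / 2 * real N)"
    proof -
      have "(\<Sum>i<N * Suc m. dist (v m i) (v m (Suc i))) \<le> real N"
        unfolding v_def by (rule N(2)) (auto intro!: divide_right_mono)
      then show ?thesis using R(1) by (intro ennreal_leI mult_left_mono) auto
    qed
    finally show ?thesis by simp
  qed
  have lim: "AE z in lborel. ennreal \<bar>?W z\<bar> = liminf (\<lambda>m. ennreal \<bar>f m z\<bar>)"
    using AE_notin_path_image[OF g(1)]
  proof eventually_elim
    case (elim z)
    have "\<forall>\<^sub>F m in sequentially. ennreal \<bar>f m z\<bar> = ennreal \<bar>?W z\<bar>"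
      using winding_off_fan_eventually[OF assms elim N(1)]
      by eventually_elim (simp add: f_def v_def)
    then have "(\<lambda>m. ennreal \<bar>f m z\<bar>) \<longlonglongrightarrow> ennreal \<bar>?W z\<bar>"
      by (rule tendsto_eventually)
    then show ?case by (metis lim_imp_Liminf trivial_limit_sequentially)
  qed
  have "(\<integral>\<^sup>+z. ennreal \<bar>?W z\<bar> \<partial>lborel) = (\<integral>\<^sup>+z. liminf (\<lambda>m. ennreal \<bar>f m z\<bar>) \<partial>lborel)"
    by (rule nn_integral_cong_AE[OF lim])
  also have "\<dots> \<le> liminf (\<lambda>m. \<integral>\<^sup>+z. ennreal \<bar>f m z\<bar> \<partial>lborel)"
    by (rule nn_integral_liminf) measurable
  also have "\<dots> \<le> liminf (\<lambda>m::nat. ennreal (R * real N / 2))"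
    using bound by (intro Liminf_mono always_eventually) auto
  also have "\<dots> = ennreal (R * real N / 2)" by (simp add: Liminf_const)
  also have "\<dots> < \<infinity>" by simp
  finally show ?thesis by (intro integrableI_bounded) simp_all
qed

lemma path_closed_up: "g \<in> plane_paths \<Longrightarrow> path (closed_up g)"
  unfolding closed_up_def using plane_pathsD by auto

lemma winding_off_closed_up_AE:
  assumes "g \<in> plane_paths"
  shows "AE z in lborel. winding_off (closed_up g) z = winding_off g z + edge (pathfinish g) 0 z"
  using AE_notin_path_image[OF plane_pathsD(1)[OF assms]] AE_notin_closed_segment[of "pathfinish g" 0]
  by eventually_elim
     (use plane_pathsD[OF assms] in \<open>auto simp: closed_up_def winding_off_joinpaths\<close>)

text \<open>Integrability of the moment follows from that of the winding function, which vanishes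
  outside a disk around the path. As \<open>winding_off\<close> is Borel and zero on the image, the
  integrals in the definitions become integrals over \<open>lborel\<close>.\<close>

lemma
  assumes "g \<in> plane_paths"
  shows has_integral_area: "has_bochner_integral lborel (winding_off (closed_up g)) (area g)"
    and has_integral_y_moment:
      "has_bochner_integral lborel (\<lambda>z. Im z * winding_off (closed_up g) z) (y_moment g)"
proof -
  note g = plane_pathsD[OF assms]
  let ?W = "winding_off (closed_up g)"
  have [measurable]: "?W \<in> borel_measurable borel"
    using path_closed_up[OF assms] by measurable
  have [measurable]: "winding_off g \<in> borel_measurable borel"
    using g(4) by measurable
  have W: "integrable lborel ?W"
  proof (rule integrable_cong_AE_imp[OF integrable_winding_off[OF assms]])
    show "AE z in lborel. winding_off g z + edge (pathfinish g) 0 z = ?W z"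
      using winding_off_closed_up_AE[OF assms] by eventually_elim simp
  qed measurable
  obtain R where R: "R > 0" "\<And>w. w \<in> path_image (closed_up g) \<Longrightarrow> norm w \<le> R"
    using bounded_path_image[OF path_closed_up[OF assms]] bounded_pos by blast
  have "integrable lborel (\<lambda>z. R * ?W z)" using W by simp
  then have yW: "integrable lborel (\<lambda>z. Im z * ?W z)"
  proof (rule Bochner_Integration.integrable_bound)
    show "AE z in lborel. norm (Im z * ?W z) \<le> norm (R * ?W z)"
    proof (intro always_eventually allI)
      fix z show "norm (Im z * ?W z) \<le> norm (R * ?W z)"
      proof (cases "norm z \<le> R")
        case True
        then have "\<bar>Im z\<bar> \<le> \<bar>R\<bar>" using abs_Im_le_cmod[of z] by linarith
        then show ?thesis by (simp add: abs_mult mult_right_mono)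
      next
        case False
        then have "winding_number (closed_up g) z = 0"
          using R(2) path_closed_up[OF assms] g(3)
          by (intro winding_number_zero_outside[of _ "cball 0 R"]) (auto simp: closed_up_def)
        then show ?thesis by (simp add: winding_off_def)
      qed
    qed
  qed measurable
  have "area g = (\<integral>z. ?W z \<partial>lebesgue)"
    unfolding area_def set_lebesgue_integral_def
    by (intro Bochner_Integration.integral_cong) (auto simp: winding_off_def winding_fun_def)
  also have "\<dots> = (\<integral>z. ?W z \<partial>lborel)" by (rule integral_completion) simp
  finally show "has_bochner_integral lborel ?W (area g)"
    using W by (simp add: has_bochner_integral_iff)
  have "y_moment g = (\<integral>z. Im z * ?W z \<partial>lebesgue)"
    unfolding y_moment_def set_lebesgue_integral_def
    by (intro Bochner_Integration.integral_cong) (auto simp: winding_off_def winding_fun_def)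
  also have "\<dots> = (\<integral>z. Im z * ?W z \<partial>lborel)" by (rule integral_completion) simp
  finally show "has_bochner_integral lborel (\<lambda>z. Im z * ?W z) (y_moment g)"
    using yW by (simp add: has_bochner_integral_iff)
qed

lemma linepath_in_plane_paths [simp]: "linepath 0 v \<in> plane_paths"
  by (simp add: plane_paths_def abs_continuous_linepath)

lemma
  shows area_linepath [simp]: "area (linepath 0 v) = 0"
    and y_moment_linepath [simp]: "y_moment (linepath 0 v) = 0"
proof -
  have "AE z in lborel. winding_off (closed_up (linepath 0 v)) z = 0"
    using winding_off_closed_up_AE[OF linepath_in_plane_paths[of v]]
    by eventually_elim (simp add: edge_reverse[of 0 v])
  then have "AE z in lborel. Im z * winding_off (closed_up (linepath 0 v)) z = 0"
    and "AE z in lborel. winding_off (closed_up (linepath 0 v)) z = 0" by auto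
  then have "(\<integral>z. Im z * winding_off (closed_up (linepath 0 v)) z \<partial>lborel) = 0"
    "(\<integral>z. winding_off (closed_up (linepath 0 v)) z \<partial>lborel) = 0"
    by (auto intro!: integral_eq_zero_AE)
  then show "area (linepath 0 v) = 0" "y_moment (linepath 0 v) = 0"
    using has_integral_area[of "linepath 0 v"] has_integral_y_moment[of "linepath 0 v"]
    by (auto simp: has_bochner_integral_iff)
qed

lemma concat_path_in_plane_paths:
  assumes "g \<in> plane_paths" "h \<in> plane_paths"
  shows "concat_path g h \<in> plane_paths"
proof -
  note g = plane_pathsD[OF assms(1)] and h = plane_pathsD[OF assms(2)]
  have "pathfinish g = pathstart (\<lambda>t. pathfinish g + h t)" using h by (simp add: pathstart_def)
  then show ?thesis
    using abs_continuous_joinpaths[OF g(1) abs_continuous_translate[OF h(1), of "pathfinish g"]] g(3)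
    by (simp add: concat_path_def plane_paths_def)
qed

lemma pathfinish_concat_path: "pathfinish (concat_path g h) = pathfinish g + pathfinish h"
  by (simp add: concat_path_def) (simp add: pathfinish_def)

lemma winding_off_translate: "winding_off (\<lambda>t. p + h t) z = winding_off h (z - p)"
proof -
  have "path_image (\<lambda>t. p + h t) = (+) p ` path_image h" by (auto simp: path_image_def)
  then have "z \<in> path_image (\<lambda>t. p + h t) \<longleftrightarrow> z - p \<in> path_image h"
    by (auto simp: image_iff) (metis add_diff_cancel_left' diff_add_cancel add.commute)
  moreover have "winding_number (\<lambda>t. p + h t) z = winding_number h (z - p)"
    by (subst (1 2) winding_number_offset) (simp add: algebra_simps)
  ultimately show ?thesis by (simp add: winding_off_def)
qed

text \<open>Closing up the concatenation differs from closing up both factors separately by the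
  boundary of the triangle with vertices \<open>0\<close>, \<open>p\<close> and \<open>p + q\<close>.\<close>

lemma winding_off_concat_AE:
  assumes "g \<in> plane_paths" "h \<in> plane_paths"
  defines "p \<equiv> pathfinish g" and "q \<equiv> pathfinish h"
  shows "AE z in lborel. winding_off (closed_up (concat_path g h)) z =
    winding_off (closed_up g) z + winding_off (closed_up h) (z - p) + tri 0 p (p + q) z"
proof -
  note g = plane_pathsD[OF assms(1)] and h = plane_pathsD[OF assms(2)]
  have ac: "abs_continuous_on_interval 0 1 (\<lambda>t. p + h t)" by (rule abs_continuous_translate[OF h(1)])
  have eq: "pathfinish g = pathstart (\<lambda>t. p + h t)" using h(2) by (simp add: pathstart_def p_def)
  \<comment> \<open>The exceptional null set of \<open>h\<close> has to be moved by
    \<open>p\<close>; this uses the translation invariance of \<open>lborel\<close>.\<close>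
  have "AE z in distr lborel borel ((+) (- p)). winding_off (closed_up h) z = winding_off h z + edge q 0 z"
    unfolding lborel_distr_plus q_def by (rule winding_off_closed_up_AE[OF assms(2)])
  then have "AE z in lborel. winding_off (closed_up h) (z - p) = winding_off h (z - p) + edge q 0 (z - p)"
    by (auto dest!: AE_distrD[rotated])
  then show ?thesis
    using winding_off_closed_up_AE[OF concat_path_in_plane_paths[OF assms(1,2)]]
      winding_off_closed_up_AE[OF assms(1)] AE_notin_path_image[OF g(1)] AE_notin_path_image[OF ac]
  proof eventually_elim
    case (elim z)
    have "winding_off (concat_path g h) z = winding_off g z + winding_off h (z - p)"
      using winding_off_joinpaths[OF g(4) abs_continuous_imp_path[OF ac] eq elim(4,5)]
      by (simp add: concat_path_def p_def winding_off_translate)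
    moreover have "edge q 0 (z - p) = edge (p + q) p z"
      using edge_affine[of 1 p q 0 "z - p"] by (simp add: add.commute)
    ultimately show ?case
      using elim(1-3) edge_reverse[of 0 p z] edge_reverse[of p "p + q" z]
      by (simp add: pathfinish_concat_path p_def q_def tri_def)
  qed
qed

text \<open>Translating the closed path of \<open>h\<close> by \<open>p\<close> adds
  \<open>Im p * area h\<close> to its moment. The triangle \<open>0\<close>, \<open>p\<close>,
  \<open>p + q\<close> contributes its signed area \<open>det2 p q / 2\<close>, and to the moment
  this area times the height \<open>(2 * Im p + Im q) / 3\<close> of its centroid.\<close>

lemma
  assumes "g \<in> plane_paths" "h \<in> plane_paths"
  shows area_concat_path: "area (concat_path g h) =
      area g + area h + det2 (pathfinish g) (pathfinish h) / 2"
    and y_moment_concat_path: "y_moment (concat_path g h) =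
      y_moment g + y_moment h + Im (pathfinish g) * area h +
      det2 (pathfinish g) (pathfinish h) * (2 * Im (pathfinish g) + Im (pathfinish h)) / 6"
proof -
  define p q where "p = pathfinish g" and "q = pathfinish h"
  let ?W = "winding_off (closed_up (concat_path g h))"
  let ?R = "\<lambda>z. winding_off (closed_up g) z + winding_off (closed_up h) (z - p) + tri 0 p (p + q) z"
  note gh = concat_path_in_plane_paths[OF assms]
  have [measurable]: "?W \<in> borel_measurable borel" "winding_off (closed_up g) \<in> borel_measurable borel"
    "winding_off (closed_up h) \<in> borel_measurable borel"
    using path_closed_up assms gh by measurable
  have AE: "AE z in lborel. ?W z = ?R z"
    using winding_off_concat_AE[OF assms] by (simp add: p_def q_def)
  have AE': "AE z in lborel. Im z * ?W z = Im z * ?R z"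
    using AE by eventually_elim simp
  have det: "det2 p (p + q) = det2 p q" by (simp add: det2_def algebra_simps)
  have "has_bochner_integral lborel ?R (area g + area h + det2 p q / 2)"
    using has_integral_area[OF assms(1)] has_bochner_integral_translate[OF has_integral_area[OF assms(2)]]
      has_integral_tri[of p "p + q"] unfolding det by (intro has_bochner_integral_add)
  then have "has_bochner_integral lborel ?W (area g + area h + det2 p q / 2)"
    by (subst has_bochner_integral_cong_AE[OF _ _ AE]) measurable
  from has_bochner_integral_eq[OF has_integral_area[OF gh] this]
  show "area (concat_path g h) = area g + area h + det2 (pathfinish g) (pathfinish h) / 2"
    by (simp add: p_def q_def)
  have "has_bochner_integral lborel (\<lambda>z. Im z * winding_off (closed_up h) (z - p))
      (y_moment h + Im p * area h)"
    using has_bochner_integral_translate[OF has_bochner_integral_add[OF has_integral_y_moment[OF assms(2)]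
      has_bochner_integral_mult_right[OF has_integral_area[OF assms(2)], of "Im p"]], of p]
    by (simp add: algebra_simps)
  from has_bochner_integral_add[OF has_bochner_integral_add[OF has_integral_y_moment[OF assms(1)] this]
    has_integral_y_tri[of p "p + q"]]
  have "has_bochner_integral lborel (\<lambda>z. Im z * ?R z)
     (y_moment g + (y_moment h + Im p * area h) + det2 p q / 2 * (Im p + Im (p + q)) / 3)"
    by (simp add: det distrib_left)
  then have "has_bochner_integral lborel (\<lambda>z. Im z * ?W z)
     (y_moment g + (y_moment h + Im p * area h) + det2 p q / 2 * (Im p + Im (p + q)) / 3)"
    by (subst has_bochner_integral_cong_AE[OF _ _ AE']) measurable
  from has_bochner_integral_eq[OF has_integral_y_moment[OF gh] this]
  show "y_moment (concat_path g h) =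
      y_moment g + y_moment h + Im (pathfinish g) * area h +
      det2 (pathfinish g) (pathfinish h) * (2 * Im (pathfinish g) + Im (pathfinish h)) / 6"
    by (simp add: p_def q_def algebra_simps)
qed

section \<open>The Engel group and polygons\<close>

lemma engel_class_eq_iff:
  assumes "g \<in> plane_paths" "h \<in> plane_paths"
  shows "engel_class g = engel_class h \<longleftrightarrow>
    pathfinish g = pathfinish h \<and> area g = area h \<and> y_moment g = y_moment h"
  using assms by (auto simp: engel_class_def engel_rel_def)

lemma mem_engel_class:
  "h \<in> engel_class g \<longleftrightarrow> g \<in> plane_paths \<and> h \<in> plane_paths \<and>
     pathfinish g = pathfinish h \<and> area g = area h \<and> y_moment g = y_moment h"
  by (auto simp: engel_class_def engel_rel_def)

lemma carrier_Engel: "carrier Engel = engel_class ` plane_paths"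
  by (auto simp: Engel_def quotient_def engel_class_def)

text \<open>Endpoint, area and moment of a concatenation depend only on those of the factors, so all
  sets in the union coincide.\<close>

lemma mult_Engel:
  assumes "g \<in> plane_paths" "h \<in> plane_paths"
  shows "engel_class g \<otimes>\<^bsub>Engel\<^esub> engel_class h = engel_class (concat_path g h)"
proof -
  have "engel_class (concat_path g' h') = engel_class (concat_path g h)"
    if "g' \<in> engel_class g" "h' \<in> engel_class h" for g' h'
    using that assms
    by (subst engel_class_eq_iff)
      (auto simp: mem_engel_class concat_path_in_plane_paths pathfinish_concat_path
        area_concat_path y_moment_concat_path)
  moreover have "g \<in> engel_class g" "h \<in> engel_class h"
    using assms by (auto simp: mem_engel_class)
  ultimately have "(\<Union>g'\<in>engel_class g. \<Union>h'\<in>engel_class h. engel_class (concat_path g' h')) =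
      engel_class (concat_path g h)"
    by (intro SUP_eq_const) blast+
  then show ?thesis by (simp add: Engel_def)
qed

lemma one_Engel: "\<one>\<^bsub>Engel\<^esub> = engel_class (\<lambda>_. 0)"
  by (simp add: Engel_def)

lemma zero_path [simp]:
  "(\<lambda>_. 0) \<in> plane_paths" "pathfinish (\<lambda>_. 0 :: complex) = 0"
  "area (\<lambda>_. 0) = 0" "y_moment (\<lambda>_. 0) = 0"
  using linepath_in_plane_paths[of 0] area_linepath[of 0] y_moment_linepath[of 0]
  unfolding linepath_refl by (simp_all add: pathfinish_def)

text \<open>\<open>m_inv\<close> is a definite description, so existence and uniqueness are both
  read off the invariants. An inverse must end at \<open>- v\<close>; this makes the determinant
  vanish, then the area, then the moment.\<close>

lemma inv_segment_elt: "inv\<^bsub>Engel\<^esub> (segment_elt v) = segment_elt (- v)"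
  unfolding m_inv_def
proof (rule the_equality)
  have "concat_path (linepath 0 v) (linepath 0 (- v)) \<in> plane_paths"
    "concat_path (linepath 0 (- v)) (linepath 0 v) \<in> plane_paths"
    by (simp_all add: concat_path_in_plane_paths)
  then show "segment_elt (- v) \<in> carrier Engel \<and>
      segment_elt v \<otimes>\<^bsub>Engel\<^esub> segment_elt (- v) = \<one>\<^bsub>Engel\<^esub> \<and>
      segment_elt (- v) \<otimes>\<^bsub>Engel\<^esub> segment_elt v = \<one>\<^bsub>Engel\<^esub>"
    by (auto simp: segment_elt_def carrier_Engel one_Engel mult_Engel engel_class_eq_iff
      pathfinish_concat_path area_concat_path y_moment_concat_path det2_def)
next
  fix y assume y: "y \<in> carrier Engel \<and>
      segment_elt v \<otimes>\<^bsub>Engel\<^esub> y = \<one>\<^bsub>Engel\<^esub> \<and> y \<otimes>\<^bsub>Engel\<^esub> segment_elt v = \<one>\<^bsub>Engel\<^esub>"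
  then obtain h where h: "h \<in> plane_paths" "y = engel_class h" by (auto simp: carrier_Engel)
  with y have "engel_class (concat_path (linepath 0 v) h) = engel_class (\<lambda>_. 0)"
    by (simp add: segment_elt_def one_Engel mult_Engel)
  then have "v + pathfinish h = 0" and
      1: "area h + det2 v (pathfinish h) / 2 = 0"
      "y_moment h + Im v * area h + det2 v (pathfinish h) * (2 * Im v + Im (pathfinish h)) / 6 = 0"
    using h(1)
    by (auto simp: engel_class_eq_iff concat_path_in_plane_paths pathfinish_concat_path
      area_concat_path y_moment_concat_path)
  then have p: "pathfinish h = - v" by (simp add: eq_neg_iff_add_eq_0 add.commute)
  then have "det2 v (pathfinish h) = 0" by (simp add: det2_def)
  with 1 have "area h = 0" "y_moment h = 0" by auto
  with p h show "y = segment_elt (- v)"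
    by (simp add: segment_elt_def engel_class_eq_iff)
qed

section \<open>Polygons and Green's formula\<close>

text \<open>The list holds edge vectors, not vertices, and the nesting to the right matches the
  \<open>foldr\<close> of \<open>rword_eval\<close>.\<close>

fun polyline :: "complex list \<Rightarrow> real \<Rightarrow> complex" where
  "polyline [] = (\<lambda>_. 0)"
| "polyline (v # vs) = concat_path (linepath 0 v) (polyline vs)"

lemma polyline_in_plane_paths [simp]: "polyline vs \<in> plane_paths"
  by (induction vs) (auto intro: concat_path_in_plane_paths)

lemma pathfinish_polyline [simp]: "pathfinish (polyline vs) = sum_list vs"
  by (induction vs) (auto simp: pathfinish_concat_path)

lemma foldr_mult_segment_elt:
  "foldr (\<otimes>\<^bsub>Engel\<^esub>) (map segment_elt vs) \<one>\<^bsub>Engel\<^esub> = engel_class (polyline vs)"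
  by (induction vs) (auto simp: one_Engel segment_elt_def mult_Engel)

text \<open>The integrals of \<open>y dx\<close> and of \<open>y\<^sup>2 \<phi>(dx)\<close> along the polygon with edge vectors \<open>vs\<close>
  that starts at height \<open>y\<close>.  With \<open>\<phi> = id\<close> the second one determines the \<open>y\<close>-moment; its parts
  over the edges that run to the right and to the left are the cases where \<open>\<phi>\<close> is the positive
  and the negative part.\<close>

fun y_integral :: "real \<Rightarrow> complex list \<Rightarrow> real" where
  "y_integral y [] = 0"
| "y_integral y (v # vs) = Re v * (y + Im v / 2) + y_integral (y + Im v) vs"

fun ysq_integral :: "(real \<Rightarrow> real) \<Rightarrow> real \<Rightarrow> complex list \<Rightarrow> real" where
  "ysq_integral \<phi> y [] = 0"
| "ysq_integral \<phi> y (v # vs) =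
     \<phi> (Re v) * (y\<^sup>2 + y * Im v + (Im v)\<^sup>2 / 3) + ysq_integral \<phi> (y + Im v) vs"

lemma y_integral_append:
  "y_integral y (xs @ ys) = y_integral y xs + y_integral (y + Im (sum_list xs)) ys"
  by (induction xs arbitrary: y) (auto simp: algebra_simps)

lemma ysq_integral_append:
  "ysq_integral \<phi> y (xs @ ys) = ysq_integral \<phi> y xs + ysq_integral \<phi> (y + Im (sum_list xs)) ys"
  by (induction xs arbitrary: y) (auto simp: algebra_simps)

lemma y_integral_shift: "y_integral y vs = y_integral 0 vs + y * Re (sum_list vs)"
proof (induction vs arbitrary: y)
  case (Cons v vs)
  show ?case
    using Cons.IH[of "y + Im v"] Cons.IH[of "Im v"] by (simp add: algebra_simps)
qed simp

text \<open>The expansion of the square of the raised height, integrated against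
  \<open>dx\<close>.\<close>

lemma ysq_integral_shift:
  "ysq_integral (\<lambda>x. x) y vs =
     ysq_integral (\<lambda>x. x) 0 vs + 2 * y * y_integral 0 vs + y\<^sup>2 * Re (sum_list vs)"
proof (induction vs arbitrary: y)
  case (Cons v vs)
  show ?case
    using Cons.IH[of "y + Im v"] Cons.IH[of "Im v"] y_integral_shift[of "Im v" vs]
    by (simp add: algebra_simps power2_eq_square)
qed simp

text \<open>Green's formula: the area is minus the integral of \<open>y dx\<close> around the closed
  polygon, and the closing segment accounts for the first term.\<close>

lemma area_polyline:
  "area (polyline vs) = Re (sum_list vs) * Im (sum_list vs) / 2 - y_integral 0 vs"
proof (induction vs)
  case (Cons v vs)
  then show ?case
    using y_integral_shift[of "Im v" vs]
    by (simp add: area_concat_path det2_def field_simps)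
qed simp

text \<open>Green's formula with \<open>y\<^sup>2 / 2\<close> in place of \<open>y\<close>; again
  the first term comes from the closing segment.\<close>

lemma y_moment_polyline:
  "y_moment (polyline vs) =
     Re (sum_list vs) * (Im (sum_list vs))\<^sup>2 / 6 - ysq_integral (\<lambda>x. x) 0 vs / 2"
proof (induction vs)
  case (Cons v vs)
  define X Y where "X = Re (sum_list vs)" and "Y = Im (sum_list vs)"
  have "y_moment (polyline (v # vs)) = y_moment (polyline vs) + Im v * area (polyline vs) +
      (Re v * Y - Im v * X) * (2 * Im v + Y) / 6"
    by (simp add: y_moment_concat_path det2_def X_def Y_def)
  also have "\<dots> = (X * Y\<^sup>2 / 6 - ysq_integral (\<lambda>x. x) 0 vs / 2) + Im v * (X * Y / 2 - y_integral 0 vs)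
      + (Re v * Y - Im v * X) * (2 * Im v + Y) / 6"
    unfolding Cons.IH area_polyline by (simp add: X_def Y_def)
  also have "\<dots> = (Re v + X) * (Im v + Y)\<^sup>2 / 6 - ysq_integral (\<lambda>x. x) 0 (v # vs) / 2"
    using ysq_integral_shift[of "Im v" vs]
    by (simp add: X_def Y_def field_simps power2_eq_square power3_eq_cube)
  finally show ?case by (simp add: X_def Y_def)
qed simp

text \<open>For an endpoint on the axis the terms of the closing segment vanish.\<close>

lemma polyline_eq_horizontal_iff:
  "engel_class (polyline vs) = horizontal_elt n \<longleftrightarrow>
     sum_list vs = of_nat n \<and> y_integral 0 vs = 0 \<and> ysq_integral (\<lambda>x. x) 0 vs = 0"
  unfolding horizontal_elt_def segment_elt_def
  by (subst engel_class_eq_iff) (auto simp: area_polyline y_moment_polyline)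

definition word_vecs :: "rword \<Rightarrow> complex list" where
  "word_vecs w = map (\<lambda>(x, \<mu>). \<mu> *\<^sub>R letter_vec x) w"

lemma rword_eval_eq: "rword_eval w = engel_class (polyline (word_vecs w))"
proof -
  have "map (\<lambda>(x, \<mu>). letter_power x \<mu>) w = map segment_elt (word_vecs w)"
    by (auto simp: word_vecs_def letter_power_def)
  then show ?thesis by (simp add: rword_eval_def foldr_mult_segment_elt)
qed

section \<open>The excess length of zigzags\<close>

text \<open>The weight is the mean of the squared height along an edge rising from \<open>y\<close>
  to \<open>y + v\<close>: the square of the height at the middle plus the variance
  \<open>v\<^sup>2 / 12\<close>.\<close>

lemma ysq_weight_nonneg: "(0::real) \<le> y\<^sup>2 + y * v + v\<^sup>2 / 3"
  and ysq_weight_ge: "(v::real)\<^sup>2 / 12 \<le> y\<^sup>2 + y * v + v\<^sup>2 / 3"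
proof -
  have "y\<^sup>2 + y * v + v\<^sup>2 / 3 = (y + v / 2)\<^sup>2 + v\<^sup>2 / 12"
    by (simp add: power2_eq_square algebra_simps)
  then show "v\<^sup>2 / 12 \<le> y\<^sup>2 + y * v + v\<^sup>2 / 3" by simp
  then show "0 \<le> y\<^sup>2 + y * v + v\<^sup>2 / 3" by (smt (verit) divide_nonneg_nonneg zero_le_power2)
qed

lemma ysq_integral_add:
  "ysq_integral (\<lambda>x. \<phi> x + \<psi> x) y vs = ysq_integral \<phi> y vs + ysq_integral \<psi> y vs"
  by (induction vs arbitrary: y) (auto simp: algebra_simps)

lemma ysq_integral_nonneg:
  assumes "\<And>x. 0 \<le> \<phi> x"
  shows "0 \<le> ysq_integral \<phi> y vs"
  by (induction vs arbitrary: y) (auto intro!: add_nonneg_nonneg mult_nonneg_nonneg assms ysq_weight_nonneg)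

text \<open>As \<bar>dx\<bar> = \<bar>dy\<bar> on every edge, the integrand is the absolute value of
  the differential of \<open>y ^ 3 / 3\<close>; the triangle inequality gives the bound.\<close>

lemma ysq_integral_abs_ge:
  assumes "\<forall>v\<in>set vs. \<bar>Im v\<bar> = \<bar>Re v\<bar>"
  shows "\<bar>(y + Im (sum_list vs))^3 - y^3\<bar> / 3 \<le> ysq_integral abs y vs"
  using assms
proof (induction vs arbitrary: y)
  case (Cons v vs)
  have "(y + Im v)^3 - y^3 = 3 * Im v * (y\<^sup>2 + y * Im v + (Im v)\<^sup>2 / 3)"
    by (simp add: power2_eq_square power3_eq_cube algebra_simps)
  then have "\<bar>(y + Im v)^3 - y^3\<bar> / 3 = \<bar>Re v\<bar> * (y\<^sup>2 + y * Im v + (Im v)\<^sup>2 / 3)"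
    using Cons.prems ysq_weight_nonneg[of y "Im v"] by (simp add: abs_mult)
  moreover have "\<bar>(y + Im v + Im (sum_list vs))^3 - (y + Im v)^3\<bar> / 3 \<le> ysq_integral abs (y + Im v) vs"
    using Cons by simp
  ultimately show ?case by (simp add: add.assoc)
qed simp

text \<open>If both ends of an edge have height at most \<open>h\<close> in absolute value, then the
  mean squared height along it is at most \<open>h\<^sup>2\<close>.\<close>

lemma ysq_integral_neg_le:
  assumes "\<forall>i\<le>length vs. \<bar>y + Im (sum_list (take i vs))\<bar> \<le> h"
  shows "ysq_integral (\<lambda>x. max (- x) 0) y vs \<le> h\<^sup>2 * (\<Sum>v\<leftarrow>vs. max (- Re v) 0)"
  using assms
proof (induction vs arbitrary: y)
  case (Cons v vs)
  have "\<bar>y\<bar> \<le> h" using Cons.prems[rule_format, of 0] by simp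
  moreover have "\<bar>y + Im v\<bar> \<le> h" using Cons.prems[rule_format, of 1] by simp
  ultimately have "y\<^sup>2 \<le> h\<^sup>2" "(y + Im v)\<^sup>2 \<le> h\<^sup>2" "\<bar>y * (y + Im v)\<bar> \<le> h * h"
    unfolding abs_mult by (auto intro!: mult_mono simp flip: abs_le_square_iff)
  moreover have "3 * (y\<^sup>2 + y * Im v + (Im v)\<^sup>2 / 3) = y\<^sup>2 + (y + Im v)\<^sup>2 + y * (y + Im v)"
    by (simp add: power2_eq_square algebra_simps)
  ultimately have "y\<^sup>2 + y * Im v + (Im v)\<^sup>2 / 3 \<le> h\<^sup>2"
    by (simp add: power2_eq_square)
  then have "max (- Re v) 0 * (y\<^sup>2 + y * Im v + (Im v)\<^sup>2 / 3) \<le> max (- Re v) 0 * h\<^sup>2"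
    by (intro mult_left_mono) auto
  moreover have "ysq_integral (\<lambda>x. max (- x) 0) (y + Im v) vs \<le> h\<^sup>2 * (\<Sum>v\<leftarrow>vs. max (- Re v) 0)"
  proof (rule Cons.IH, intro allI impI)
    fix i assume "i \<le> length vs"
    then show "\<bar>y + Im v + Im (sum_list (take i vs))\<bar> \<le> h"
      using Cons.prems[rule_format, of "Suc i"] by (simp add: add.assoc)
  qed
  ultimately show ?case by (simp add: algebra_simps)
qed simp

text \<open>The cube is replaced by its tangent at \<open>c\<close>; the choice \<open>c = P / k\<close> then yields the
  power mean inequality.\<close>

lemma ysq_integral_pos_ge:
  assumes "\<forall>v\<in>set vs. \<bar>Im v\<bar> = \<bar>Re v\<bar>" "c \<ge> 0"
  shows "(3 * c\<^sup>2 * (\<Sum>v\<leftarrow>vs. max (Re v) 0) - 2 * c^3 * real (length vs)) / 12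
    \<le> ysq_integral (\<lambda>x. max x 0) y vs"
  using assms(1)
proof (induction vs arbitrary: y)
  case (Cons v vs)
  define m where "m = max (Re v) 0"
  have "m \<ge> 0" by (simp add: m_def)
  have "m^3 - 3 * c\<^sup>2 * m + 2 * c^3 = (m - c)\<^sup>2 * (m + 2 * c)"
    by (simp add: power2_eq_square power3_eq_cube algebra_simps)
  also have "\<dots> \<ge> 0" using \<open>m \<ge> 0\<close> \<open>c \<ge> 0\<close> by simp
  finally have "(3 * c\<^sup>2 * m - 2 * c^3) / 12 \<le> m^3 / 12" by simp
  also have "m^3 / 12 = m * ((Im v)\<^sup>2 / 12)"
  proof -
    have "(Im v)\<^sup>2 = (Re v)\<^sup>2" using Cons.prems by (metis list.set_intros(1) power2_abs)
    then show ?thesis by (simp add: m_def max_def power3_eq_cube power2_eq_square)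
  qed
  also have "\<dots> \<le> m * (y\<^sup>2 + y * Im v + (Im v)\<^sup>2 / 3)"
    using \<open>m \<ge> 0\<close> ysq_weight_ge by (intro mult_left_mono)
  finally show ?case
    using Cons.IH[of "y + Im v"] Cons.prems unfolding m_def[symmetric]
    by (simp add: algebra_simps m_def[symmetric] add_divide_distrib diff_divide_distrib)
qed simp

text \<open>Write \<open>M\<close> for the total length of the edges running to the left.  The height \<open>y\<close> along the
  polygon satisfies \<open>\<bar>y\<bar>\<^sup>3 \<le> 3 I\<close>, where \<open>I\<close> is the common value of the integrals of \<open>y\<^sup>2 \<bar>dx\<bar>\<close> over the
  edges to the right and over the edges to the left, since \<open>\<bar>dx\<bar> = \<bar>dy\<bar>\<close> and the polygon
  returns to height \<open>0\<close>.  Hence \<open>I \<le> (3 I) powr (2/3) * M\<close>, that is \<open>I \<le> 9 M\<^sup>3\<close>, whereas \<open>k\<close> edges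
  of total length at least \<open>n\<close> force \<open>12 I \<ge> n\<^sup>3 / k\<^sup>2\<close>.\<close>

lemma zigzag_excess:
  assumes vs: "\<forall>v\<in>set vs. \<bar>Im v\<bar> = \<bar>Re v\<bar>"
    and sum: "sum_list vs = of_real n" "n > 0" and mom: "ysq_integral (\<lambda>x. x) 0 vs = 0"
  defines "l \<equiv> (\<Sum>v\<leftarrow>vs. \<bar>Re v\<bar>)" and "k \<equiv> real (length vs)"
  shows "2 * n^3 \<le> 27 * k\<^sup>2 * (l - n)^3"
proof -
  define P where "P = (\<Sum>v\<leftarrow>vs. max (Re v) 0)"
  define M where "M = (\<Sum>v\<leftarrow>vs. max (- Re v) 0)"
  define I where "I = ysq_integral (\<lambda>x. max (- x) 0) 0 vs"
  have "P - M = Re (sum_list vs)" "P + M = l"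
    unfolding P_def M_def l_def by (induction vs) auto
  then have PM: "P = n + M" "l - n = 2 * M" using sum by auto
  have "M \<ge> 0" unfolding M_def by (intro sum_list_nonneg) auto
  have "length vs > 0" using sum by (cases vs) auto
  then have "k > 0" by (simp add: k_def)
  have eq: "ysq_integral (\<lambda>x. max x 0) 0 vs = I"
  proof -
    have "(\<lambda>x::real. max x 0) = (\<lambda>x. x + max (- x) 0)" by auto
    then show ?thesis using ysq_integral_add[of "\<lambda>x. x" "\<lambda>x. max (- x) 0" 0 vs] mom
      by (simp add: I_def)
  qed
  have J: "ysq_integral abs 0 vs = 2 * I"
  proof -
    have "(abs :: real \<Rightarrow> real) = (\<lambda>x. max x 0 + max (- x) 0)" by auto
    then show ?thesis using ysq_integral_add[of "\<lambda>x. max x 0" "\<lambda>x. max (- x) 0" 0 vs] eq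
      by (simp add: I_def)
  qed
  have "I \<ge> 0" unfolding I_def by (rule ysq_integral_nonneg) simp
  define h where "h = root 3 (3 * I)"
  have h: "h \<ge> 0" "h^3 = 3 * I" using \<open>I \<ge> 0\<close> by (auto simp: h_def)
  have height: "\<bar>Im (sum_list (take i vs))\<bar> \<le> h" for i
  proof -
    define y where "y = Im (sum_list (take i vs))"
    have "sum_list vs = sum_list (take i vs) + sum_list (drop i vs)"
      by (metis append_take_drop_id sum_list_append)
    then have "Im (sum_list (drop i vs)) = - y"
      using sum by (simp add: y_def complex_eq_iff)
    moreover have "\<bar>(0 + Im (sum_list (take i vs)))^3 - 0^3\<bar> / 3 \<le> ysq_integral abs 0 (take i vs)"
      by (rule ysq_integral_abs_ge) (use vs set_take_subset in fast)
    moreover have "\<bar>(y + Im (sum_list (drop i vs)))^3 - y^3\<bar> / 3 \<le> ysq_integral abs y (drop i vs)"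
      by (rule ysq_integral_abs_ge) (use vs set_drop_subset in fast)
    moreover have "ysq_integral abs 0 vs = ysq_integral abs 0 (take i vs) + ysq_integral abs y (drop i vs)"
      using ysq_integral_append[of abs 0 "take i vs" "drop i vs"] by (simp add: y_def)
    \<comment> \<open>Climbing to height \<open>y\<close> and returning to \<open>0\<close> each use
      up \<open>\<bar>y\<bar> ^ 3 / 3\<close> of the total \<open>2 * I\<close>.\<close>
    ultimately have "\<bar>y^3\<bar> / 3 + \<bar>y^3\<bar> / 3 \<le> 2 * I" using J by (simp add: y_def)
    then have "\<bar>y\<bar>^3 \<le> h^3" using h by (simp add: power_abs)
    then show ?thesis using h(1) by (simp add: y_def power_mono_iff)
  qed
  have "I \<le> h\<^sup>2 * M"
    unfolding I_def M_def by (rule ysq_integral_neg_le) (simp add: height)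
  \<comment> \<open>Here \<open>I\<close> is replaced by \<open>h ^ 3 / 3\<close>.\<close>
  then have "h\<^sup>2 * h \<le> h\<^sup>2 * (3 * M)" using h(2) by (simp add: power2_eq_square power3_eq_cube)
  then have "h \<le> 3 * M"
    using \<open>M \<ge> 0\<close> h(1) by (cases "h = 0") auto
  then have "h^3 \<le> (3 * M)^3" using h(1) by (rule power_mono)
  then have "I \<le> 9 * M^3" using h(2) by (simp add: power_mult_distrib)
  moreover have "P^3 / (12 * k\<^sup>2) \<le> I"
  proof -
    have "(3 * (P / k)\<^sup>2 * P - 2 * (P / k)^3 * k) / 12 \<le> I"
      using ysq_integral_pos_ge[OF vs, of "P / k" 0] sum(2) \<open>M \<ge> 0\<close> \<open>k > 0\<close>
      unfolding eq P_def[symmetric] k_def[symmetric] by (simp add: PM)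
    moreover have "(3 * (P / k)\<^sup>2 * P - 2 * (P / k)^3 * k) / 12 = P^3 / (12 * k\<^sup>2)"
      using \<open>k > 0\<close> by (simp add: power2_eq_square power3_eq_cube field_simps)
    ultimately show ?thesis by simp
  qed
  ultimately have "P^3 / (12 * k\<^sup>2) \<le> 9 * M^3" by simp
  then have "P^3 \<le> 108 * k\<^sup>2 * M^3" using \<open>k > 0\<close> by (simp add: field_simps)
  moreover have "n^3 \<le> P^3" using PM \<open>M \<ge> 0\<close> sum(2) by (intro power_mono) auto
  \<comment> \<open>From \<open>l - n = 2 * M\<close> the constant \<open>108\<close> becomes
    \<open>108 / 8 = 27 / 2\<close>.\<close>
  ultimately show ?thesis unfolding PM by (simp add: power_mult_distrib mult_ac)
qed

text \<open>Cube root of the preceding estimate. Weakening \<open>2 / 27\<close> to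
  \<open>1 / 27\<close> gives the rational constant \<open>1 / 3\<close>.\<close>

lemma zigzag_excess_powr:
  assumes vs: "\<forall>v\<in>set vs. \<bar>Im v\<bar> = \<bar>Re v\<bar>"
    and sum: "sum_list vs = of_real n" "n > 0" and mom: "ysq_integral (\<lambda>x. x) 0 vs = 0"
  shows "1 / 3 * real (length vs) powr (- (2/3)) * n \<le> (\<Sum>v\<leftarrow>vs. \<bar>Re v\<bar>) - n"
proof -
  define l k where "l = (\<Sum>v\<leftarrow>vs. \<bar>Re v\<bar>)" and "k = real (length vs)"
  have "length vs > 0" using sum by (cases vs) auto
  then have "k > 0" by (simp add: k_def)
  define r where "r = k powr (- (2/3))"
  have "r > 0" using \<open>k > 0\<close> by (simp add: r_def)
  have "r^3 = k powr (- 2)" using \<open>k > 0\<close> by (simp add: r_def powr_power)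
  then have r: "k\<^sup>2 * r^3 = 1"
    using \<open>k > 0\<close> by (simp add: powr_minus powr_numeral)
  have le: "2 * n^3 \<le> 27 * k\<^sup>2 * (l - n)^3"
    using zigzag_excess[OF vs sum mom] by (simp add: l_def k_def)
  have "n \<le> l"
  proof -
    have "Re (sum_list vs) \<le> l" unfolding l_def by (induction vs) auto
    then show ?thesis using sum by simp
  qed
  have "(1 / 3 * r * n)^3 = n^3 * r^3 / 27" by (simp add: power_mult_distrib power_divide)
  also have "\<dots> \<le> 2 * n^3 * r^3 / 27" using \<open>r > 0\<close> sum(2) by simp
  also have "\<dots> \<le> 27 * k\<^sup>2 * (l - n)^3 * r^3 / 27"
    using le \<open>r > 0\<close> by (intro divide_right_mono mult_right_mono) auto
  also have "\<dots> = k\<^sup>2 * r^3 * (l - n)^3" by simp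
  also have "\<dots> = (l - n)^3" using r by simp
  finally have "1 / 3 * r * n \<le> l - n"
    by (rule power_le_imp_le_base[of _ 2, simplified]) (use \<open>n \<le> l\<close> in simp)
  then show ?thesis by (simp add: r_def l_def k_def)
qed

section \<open>Norms of horizontal elements\<close>

lemma letter_vec_coords: "\<bar>Re (letter_vec x)\<bar> = 1" "\<bar>Im (letter_vec x)\<bar> = 1"
  by (cases x; simp)+

text \<open>Both coordinates of a letter are \<open>1\<close> in absolute value, so the length of a
  word is the horizontal variation of its polygon. Adjacent letters may coincide, so that words in
  the generators are covered as well.\<close>

lemma rword_excess:
  assumes "\<forall>(x, \<mu>)\<in>set w. \<mu> > 0" "rword_eval w = horizontal_elt n" "n > 0"
  shows "1 / 3 * real (length w) powr (- (2/3)) * real n \<le> rword_length w - real n"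
proof -
  have "(\<Sum>v\<leftarrow>word_vecs w. \<bar>Re v\<bar>) = rword_length w"
    using assms(1) by (induction w) (auto simp: word_vecs_def rword_length_def abs_mult letter_vec_coords)
  moreover have "\<forall>v\<in>set (word_vecs w). \<bar>Im v\<bar> = \<bar>Re v\<bar>"
    by (auto simp: word_vecs_def abs_mult letter_vec_coords)
  ultimately show ?thesis
    using zigzag_excess_powr[of "word_vecs w" "real n"] assms(2,3)
    by (simp add: rword_eval_eq polyline_eq_horizontal_iff word_vecs_def)
qed

text \<open>A zigzag of \<open>j\<^sup>3\<close> double teeth of height \<open>s\<close> about the axis, whose \<open>y\<^sup>2\<close>-integral is cancelled by
  a single backward double tooth of height \<open>j s\<close>.\<close>

definition zigzag_word :: "nat \<Rightarrow> real \<Rightarrow> rword" where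
  "zigzag_word j s =
     (La, s) # concat (replicate (j^3 - 1) [(Lb, 2 * s), (La, 2 * s)]) @
     [(Lb, 2 * s), (La, s), (Lb_inv, real j * s), (La_inv, 2 * (real j * s)), (Lb_inv, real j * s)]"

lemma zigzag_word_in_rwords:
  assumes "s > 0" "j > 0"
  shows "zigzag_word j s \<in> rwords"
proof -
  have "distinct_adj (La # map fst (concat (replicate m [(Lb, 2 * s), (La, 2 * s)])) @ Lb # ls)"
    if "distinct_adj (Lb # ls)" for m ls
    using that by (induction m) auto
  then show ?thesis
    using assms unfolding rwords_def zigzag_word_def by auto
qed

text \<open>Each period starts at the top \<open>s\<close> of a tooth, descends to
  \<open>- s\<close> and returns, so its integral of \<open>y dx\<close> vanishes.\<close>

lemma concat_replicate_integrals:
  fixes xs :: rword and s :: real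
  assumes "xs = concat (replicate m [(Lb, 2 * s), (La, 2 * s)])"
  shows "sum_list (word_vecs xs) = of_real (4 * s * real m)"
    "y_integral s (word_vecs xs) = 0"
    "ysq_integral (\<lambda>x. x) s (word_vecs xs) = 4 / 3 * s^3 * real m"
    "rword_length xs = 4 * s * real m"
  unfolding assms
  by (induction m) (auto simp: word_vecs_def rword_length_def complex_eq_iff algebra_simps
    power2_eq_square power3_eq_cube)

text \<open>The forward teeth give \<open>4 / 3 * s ^ 3 * j ^ 3\<close> and the backward tooth
  \<open>- 4 / 3 * (j * s) ^ 3\<close>. The backward length \<open>4 * j * s\<close> must also be
  made up for by forward edges, hence the excess \<open>8 * j * s\<close>.\<close>

lemma
  assumes "j > 0"
  shows rword_eval_zigzag_word:
      "4 * s * (real j ^ 3 - real j) = real n \<Longrightarrow> rword_eval (zigzag_word j s) = horizontal_elt n"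
    and rword_length_zigzag_word:
      "4 * s * (real j ^ 3 - real j) = real n \<Longrightarrow> rword_length (zigzag_word j s) = real n + 8 * real j * s"
proof -
  define m J where "m = j^3 - 1" and "J = real j"
  define xs where "xs = concat (replicate m [(Lb, 2 * s), (La, 2 * s)])"
  note xs = concat_replicate_integrals[OF xs_def]
  have m: "real m = J^3 - 1" using assms by (simp add: m_def J_def of_nat_diff)
  assume n: "4 * s * (real j ^ 3 - real j) = real n"
  have word: "zigzag_word j s = (La, s) # xs @
      [(Lb, 2 * s), (La, s), (Lb_inv, J * s), (La_inv, 2 * (J * s)), (Lb_inv, J * s)]"
    by (simp add: zigzag_word_def xs_def m_def J_def)
  have vecs: "word_vecs (zigzag_word j s) = Complex s s # word_vecs xs @
      [Complex (2 * s) (- 2 * s), Complex s s, Complex (- J * s) (J * s),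
       Complex (- 2 * (J * s)) (- 2 * (J * s)), Complex (- J * s) (J * s)]"
    by (simp add: word_vecs_def word complex_eq_iff)
  have "sum_list (word_vecs (zigzag_word j s)) = of_real (4 * s * (real m + 1 - J))"
    unfolding vecs by (simp add: xs complex_eq_iff algebra_simps)
  moreover have "y_integral 0 (word_vecs (zigzag_word j s)) = 0"
    unfolding vecs by (simp add: xs y_integral_append algebra_simps)
  moreover have "ysq_integral (\<lambda>x. x) 0 (word_vecs (zigzag_word j s)) =
      4 / 3 * s^3 * (real m + 1) - 4 / 3 * (J * s)^3"
    unfolding vecs by (simp add: xs ysq_integral_append algebra_simps power2_eq_square power3_eq_cube)
  ultimately show "rword_eval (zigzag_word j s) = horizontal_elt n"
    unfolding rword_eval_eq polyline_eq_horizontal_iff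
    using n by (simp add: m J_def power_mult_distrib)
  have "rword_length (zigzag_word j s) = 4 * s * (real m + 1 + J)"
    using xs(4) unfolding word by (simp add: rword_length_def algebra_simps)
  then show "rword_length (zigzag_word j s) = real n + 8 * real j * s"
    using n by (simp add: m J_def algebra_simps)
qed

text \<open>The zigzag with parameter \<open>j\<close> exceeds \<open>n\<close> by
  \<open>2 * n / (j\<^sup>2 - 1)\<close>, which tends to \<open>0\<close>.\<close>

lemma stoll_norm_horizontal_le:
  assumes "n > 0"
  shows "0 \<le> stoll_norm (horizontal_elt n)" "stoll_norm (horizontal_elt n) \<le> real n"
proof -
  let ?S = "{rword_length w |w. w \<in> rwords \<and> rword_eval w = horizontal_elt n}"
  have nonneg: "0 \<le> x" if "x \<in> ?S" for x
    using that by (fastforce simp: rwords_def rword_length_def intro!: sum_list_nonneg)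
  have mem: "real n + 2 * real n / ((real j)\<^sup>2 - 1) \<in> ?S" if "j \<ge> 2" for j
  proof -
    define D where "D = real j ^ 3 - real j"
    \<comment> \<open>The tooth height for which the zigzag ends at \<open>n\<close>.\<close>
    define s where "s = real n / (4 * D)"
    have j: "real j \<ge> 2" using that by simp
    have fac: "D = real j * ((real j)\<^sup>2 - 1)"
      by (simp add: D_def power2_eq_square power3_eq_cube algebra_simps)
    have "(real j)\<^sup>2 \<ge> 2\<^sup>2" using j by (intro power_mono) auto
    then have pos: "(real j)\<^sup>2 - 1 > 0" by simp
    then have "D > 0" unfolding fac using j by simp
    then have "4 * s * D = real n" "s > 0"
      using assms by (simp_all add: s_def)
    moreover have "8 * real j * s = 2 * real n / ((real j)\<^sup>2 - 1)"
    proof -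
      have cancel: "8 * J * (real n / (4 * (J * c))) = 2 * real n / c" if "J > 0" "c > 0" for J c
        using that by simp
      show ?thesis unfolding s_def fac by (rule cancel) (use j pos in auto)
    qed
    ultimately show ?thesis
      using rword_eval_zigzag_word[of j s n] rword_length_zigzag_word[of j s n]
        zigzag_word_in_rwords[of s j] that D_def
      by (intro CollectI exI[of _ "zigzag_word j s"]) auto
  qed
  then have "?S \<noteq> {}" by blast
  then show "0 \<le> stoll_norm (horizontal_elt n)"
    unfolding stoll_norm_def using nonneg by (intro cInf_greatest)
  have bdd: "bdd_below ?S" using nonneg by (intro bdd_belowI)
  show "stoll_norm (horizontal_elt n) \<le> real n"
  proof (rule field_le_epsilon)
    fix e :: real assume "e > 0"
    obtain i :: nat where i: "2 * real n / e < real i" using reals_Archimedean2 by blast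
    \<comment> \<open>Ensures \<open>j \<ge> 2\<close> and that \<open>j\<^sup>2 - 1\<close> is at
      least \<open>i\<close>.\<close>
    define j where "j = i + 2"
    have rj: "real j = real i + 2" by (simp add: j_def)
    have "(real j)\<^sup>2 - 1 = (real i)\<^sup>2 + 4 * real i + 3"
      unfolding rj by (simp add: power2_eq_square algebra_simps)
    then have j: "real i \<le> (real j)\<^sup>2 - 1" "0 < (real j)\<^sup>2 - 1"
      using zero_le_power2[of "real i"] by linarith+
    then have "2 * real n / e \<le> (real j)\<^sup>2 - 1" using i by linarith
    then have "2 * real n / ((real j)\<^sup>2 - 1) \<le> e"
      using j(2) \<open>e > 0\<close> by (simp add: divide_le_eq mult.commute)
    moreover have "stoll_norm (horizontal_elt n) \<le> real n + 2 * real n / ((real j)\<^sup>2 - 1)"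
      unfolding stoll_norm_def by (rule cInf_lower[OF mem bdd]) (simp add: j_def)
    ultimately show "stoll_norm (horizontal_elt n) \<le> real n + e" by linarith
  qed
qed

section \<open>Words in the generators\<close>

lemma engel_gens_eq: "engel_gens = range (\<lambda>x. segment_elt (letter_vec x))"
proof -
  have letters: "(UNIV :: letter set) = {La, La_inv, Lb, Lb_inv}"
    using letter.exhaust by auto
  have "- Complex 1 1 = Complex (- 1) (- 1)" "- Complex 1 (- 1) = Complex (- 1) 1"
    by (simp_all add: complex_eq_iff)
  then show ?thesis
    unfolding engel_gens_def gen_a_def gen_b_def inv_segment_elt letters by simp
qed

lemma foldr_mult_in_engel_lattice:
  assumes "set xs \<subseteq> engel_gens"
  shows "foldr (\<otimes>\<^bsub>Engel\<^esub>) xs \<one>\<^bsub>Engel\<^esub> \<in> engel_lattice"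
  using assms unfolding engel_lattice_def engel_gens_def
  by (induction xs) (auto intro: generate.intros)

text \<open>Found by a computer search; no shorter word in the generators represents
  \<open>horizontal_elt 12\<close>.\<close>

definition twelve_word :: "letter list" where
  "twelve_word = [La, La, La, Lb_inv, La_inv, Lb, Lb, Lb, La, Lb, La, Lb, Lb, Lb, La, La]"

text \<open>Every copy of the word ends on the axis, so the integrals of successive copies simply
  add up.\<close>

lemma twelve_word_power:
  defines "vs \<equiv> \<lambda>m. map letter_vec (concat (replicate m twelve_word))"
  shows "engel_class (polyline (vs m)) = horizontal_elt (12 * m)"
proof -
  have 1: "sum_list (map letter_vec twelve_word) = 12" "y_integral 0 (map letter_vec twelve_word) = 0"
    "ysq_integral (\<lambda>x. x) 0 (map letter_vec twelve_word) = 0"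
    by (simp_all add: twelve_word_def complex_eq_iff power2_eq_square)
  have "sum_list (vs m) = of_nat (12 * m) \<and> y_integral 0 (vs m) = 0 \<and> ysq_integral (\<lambda>x. x) 0 (vs m) = 0"
    unfolding vs_def by (induction m) (auto simp: 1 y_integral_append ysq_integral_append algebra_simps)
  then show ?thesis by (simp add: polyline_eq_horizontal_iff)
qed

lemma horizontal_elt_word_exists:
  assumes "n mod 12 = 0"
  obtains xs where "set xs \<subseteq> engel_gens" "foldr (\<otimes>\<^bsub>Engel\<^esub>) xs \<one>\<^bsub>Engel\<^esub> = horizontal_elt n"
proof -
  obtain m where n: "n = 12 * m" using assms by auto
  let ?ls = "concat (replicate m twelve_word)"
  show thesis
  proof (rule that[of "map segment_elt (map letter_vec ?ls)"])
    show "set (map segment_elt (map letter_vec ?ls)) \<subseteq> engel_gens"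
      by (auto simp: engel_gens_eq)
    show "foldr (\<otimes>\<^bsub>Engel\<^esub>) (map segment_elt (map letter_vec ?ls)) \<one>\<^bsub>Engel\<^esub> = horizontal_elt n"
      using twelve_word_power[of m] unfolding foldr_mult_segment_elt n .
  qed
qed

text \<open>A shortest word in the generators is an expression with \<open>N\<close> unit exponents,
  so both its length and its number of letters are \<open>N\<close>. For
  \<open>N \<le> 2 * n\<close> the excess bound is of order \<open>n powr (1/3)\<close>; otherwise
  the excess is at least \<open>n\<close>.\<close>

lemma word_norm_horizontal_excess:
  assumes "n > 0" "n mod 12 = 0"
  shows "1 / 6 * real n powr (1/3) \<le> real (word_norm Engel engel_gens (horizontal_elt n)) - real n"
proof -
  define N where "N = word_norm Engel engel_gens (horizontal_elt n)"
  have "\<exists>N xs. length xs = N \<and> set xs \<subseteq> engel_gens \<and>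
      foldr (\<otimes>\<^bsub>Engel\<^esub>) xs \<one>\<^bsub>Engel\<^esub> = horizontal_elt n"
    using horizontal_elt_word_exists[OF assms(2)] by metis
  then have "\<exists>xs. length xs = N \<and> set xs \<subseteq> engel_gens \<and>
      foldr (\<otimes>\<^bsub>Engel\<^esub>) xs \<one>\<^bsub>Engel\<^esub> = horizontal_elt n"
    unfolding N_def word_norm_def by (rule LeastI_ex)
  then obtain xs where xs: "length xs = N" "set xs \<subseteq> engel_gens"
      "foldr (\<otimes>\<^bsub>Engel\<^esub>) xs \<one>\<^bsub>Engel\<^esub> = horizontal_elt n" by blast
  from xs(2) have "\<exists>ls. xs = map (\<lambda>x. segment_elt (letter_vec x)) ls"
    unfolding engel_gens_eq by (metis ex_map_conv rangeE subset_iff)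
  then obtain ls where ls: "xs = map (\<lambda>x. segment_elt (letter_vec x)) ls" by blast
  define w where "w = map (\<lambda>x. (x, 1::real)) ls"
  have "map (\<lambda>(x, \<mu>). letter_power x \<mu>) w = xs"
    by (simp add: w_def ls letter_power_def)
  then have "rword_eval w = horizontal_elt n" using xs(3) by (simp add: rword_eval_def)
  moreover have "length w = N" using xs(1) ls by (simp add: w_def)
  moreover have "rword_length w = real N"
    using xs(1) ls by (simp add: w_def rword_length_def o_def sum_list_triv)
  ultimately have excess: "1 / 3 * real N powr (- (2/3)) * real n \<le> real N - real n"
    using rword_excess[of w n] assms(1) by (auto simp: w_def)
  have n: "real n \<ge> 1" using assms(1) by simp
  have "0 \<le> 1 / 3 * real N powr (- (2/3)) * real n" by simp
  then have "real N \<ge> real n" using excess by linarith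
  show ?thesis
  proof (cases "N \<le> 2 * n")
    case True
    \<comment> \<open>This crude bound turns the constant \<open>1 / 3\<close> into
      \<open>1 / 6\<close>.\<close>
    have "2 powr (- (2/3)) \<ge> (2::real) powr (- 1)" by (intro powr_mono) auto
    then have "1 / 2 * real n powr (1/3) \<le> 2 powr (- (2/3)) * real n powr (1/3)"
      by (intro mult_right_mono) (auto simp: powr_minus)
    also have "\<dots> = 2 powr (- (2/3)) * (real n powr (- (2/3)) * real n powr 1)"
      by (simp only: flip: powr_add) simp
    also have "\<dots> = (2 * real n) powr (- (2/3)) * real n"
      using n by (simp add: powr_mult)
    also have "\<dots> \<le> real N powr (- (2/3)) * real n"
      using True n \<open>real N \<ge> real n\<close> by (intro mult_right_mono powr_mono2') auto
    finally show ?thesis using excess by (simp add: N_def)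
  next
    case False
    have "real n powr (1/3) \<le> real n powr 1" using n by (intro powr_mono) auto
    moreover have "real N - real n \<ge> real n" using False by linarith
    ultimately show ?thesis using n by (simp add: N_def)
  qed
qed

text \<open>Since the Stoll norm is at most \<open>n\<close>, bounds in terms of \<open>n\<close>
  imply those in terms of the norm. The last two parts concern multiples of \<open>12\<close>, which
  are represented by powers of \<open>twelve_word\<close>.\<close>

theorem corollary4p5:
  shows "(\<exists>C'>0. \<forall>n>0. \<forall>w\<in>rwords. rword_eval w = horizontal_elt n \<longrightarrow>
            rword_length w - stoll_norm (horizontal_elt n)
              \<ge> C' * real (coarse_length w) powr (- (2/3)) * stoll_norm (horizontal_elt n))
       \<and> (\<forall>n>0. n mod 12 = 0 \<longrightarrow> horizontal_elt n \<in> engel_lattice)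
       \<and> (\<exists>c>0. \<forall>n>0. n mod 12 = 0 \<longrightarrow>
            real (word_norm Engel engel_gens (horizontal_elt n)) - stoll_norm (horizontal_elt n)
              \<ge> c * stoll_norm (horizontal_elt n) powr (1/3))"
proof (intro conjI)
  show "\<exists>C'>0. \<forall>n>0. \<forall>w\<in>rwords. rword_eval w = horizontal_elt n \<longrightarrow>
            rword_length w - stoll_norm (horizontal_elt n)
              \<ge> C' * real (coarse_length w) powr (- (2/3)) * stoll_norm (horizontal_elt n)"
  proof (intro exI[of _ "1 / 3"] conjI allI impI ballI)
    fix n :: nat and w assume n: "n > 0" and w: "w \<in> rwords" "rword_eval w = horizontal_elt n"
    have "1 / 3 * real (coarse_length w) powr (- (2/3)) * stoll_norm (horizontal_elt n)
        \<le> 1 / 3 * real (coarse_length w) powr (- (2/3)) * real n"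
      using stoll_norm_horizontal_le[OF n] by (intro mult_left_mono) auto
    also have "\<dots> \<le> rword_length w - real n"
      using rword_excess[OF _ w(2) n] w(1) by (simp add: rwords_def coarse_length_def)
    also have "\<dots> \<le> rword_length w - stoll_norm (horizontal_elt n)"
      using stoll_norm_horizontal_le[OF n] by simp
    finally show "1 / 3 * real (coarse_length w) powr (- (2/3)) * stoll_norm (horizontal_elt n)
        \<le> rword_length w - stoll_norm (horizontal_elt n)" .
  qed simp
  show "\<forall>n>0. n mod 12 = 0 \<longrightarrow> horizontal_elt n \<in> engel_lattice"
    by (metis foldr_mult_in_engel_lattice horizontal_elt_word_exists)
  show "\<exists>c>0. \<forall>n>0. n mod 12 = 0 \<longrightarrow>
            real (word_norm Engel engel_gens (horizontal_elt n)) - stoll_norm (horizontal_elt n)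
              \<ge> c * stoll_norm (horizontal_elt n) powr (1/3)"
  proof (intro exI[of _ "1 / 6"] conjI allI impI)
    fix n :: nat assume n: "n > 0" "n mod 12 = 0"
    have "stoll_norm (horizontal_elt n) powr (1/3) \<le> real n powr (1/3)"
      using stoll_norm_horizontal_le[OF n(1)] by (intro powr_mono2) auto
    then show "1 / 6 * stoll_norm (horizontal_elt n) powr (1/3)
        \<le> real (word_norm Engel engel_gens (horizontal_elt n)) - stoll_norm (horizontal_elt n)"
      using word_norm_horizontal_excess[OF n] stoll_norm_horizontal_le[OF n(1)] by linarith
  qed simp
qed

end
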